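(* Let $(X,T)$ be an essentially minimal Cantor system of finite topological rank, and let $(Y,S)$ be a minimal system on a Cantor set such that for some continuous map $\alpha: X\to Y$ one has $\alpha\circ T=S\circ\alpha$. Then $\mathrm{rank}_{\mathrm{top}}(Y,S)\le 3\,\mathrm{rank}_{\mathrm{top}}(X,T)$.
   Context: A topological dynamical system is a pair $(X,T)$ with $X$ a (nonempty) compact metric space and $T:X\to X$ a homeomorphism. It is a Cantor system if $X$ is a Cantor space (nonempty, compact, metrizable, totally disconnected, without isolated points). A subsystem is a nonempty closed invariant subset $Z$ with the restriction of $T$. The system is minimal if every orbit $\{T^n x\}_{n\in\mathbb Z}$ is dense, and essentially minimal if it has a unique minimal subsystem. Topological rank. Let $X$ be a compact totally disconnected metrizable space and $(X,T)$ essentially minimal. A Kakutani-Rokhlin partition is a finite partition of $X$ into nonempty clopen sets of the form $\{T^{j}B_{i} : 1\le i\le k,\ 0\le j<h_i\}$; for each $i$ the family $\{T^jB_i:0\le j<h_i\}$ is called a tower, and $\bigcup_{i=1}^k B_i$ is the base. A realization of $(X,T)$ is a sequence $(\mathcal T_n)_{n\ge1}$ of Kakutani-Rokhlin partitions such that $\mathcal T_{n+1}$ refines $\mathcal T_n$, the base of $\mathcal T_{n+1}$ is contained in the base of $\mathcal T_n$, the intersection of all the bases is a single point, and $\bigcup_n\mathcal T_n$ generates the topology of $X$. Writing $\#\mathcal T_n$ for the number of towers of $\mathcal T_n$, the system has finite topological rank if it has a realization with $\max_n\#\mathcal T_n<\infty$; the topological rank $\mathrm{rank}_{\mathrm{top}}(X,T)$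 is the minimum value of $\max_n\#\mathcal T_n$ over all such realizations, and it is $\infty$ if there are none. *)

theory Defs
  imports "HOL-Analysis.Analysis" "HOL-Library.Extended_Nat" "HOL-Library.Disjoint_Sets"
begin

text \<open>
  Spaces are subsets of a type of class \<^class>\<open>metric_space\<close> with the subspace topology; maps are
  total functions of which only the values on the space matter.
\<close>

definition topological_dynamical_system :: "'a::metric_space set \<Rightarrow> ('a \<Rightarrow> 'a) \<Rightarrow> bool" where
  "topological_dynamical_system X T \<longleftrightarrow>
     X \<noteq> {} \<and> compact X \<and> homeomorphism X X T (inv_into X T)"

definition totally_disconnected :: "'a::topological_space set \<Rightarrow> bool" where
  "totally_disconnected X \<longleftrightarrow> (\<forall>x\<in>X. connected_component_set X x = {x})"

definition Cantor_space :: "'a::metric_space set \<Rightarrow> bool" where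
  "Cantor_space X \<longleftrightarrow>
     X \<noteq> {} \<and> compact X \<and> totally_disconnected X \<and> (\<forall>x. \<not> x isolated_in X)"

definition Cantor_system :: "'a::metric_space set \<Rightarrow> ('a \<Rightarrow> 'a) \<Rightarrow> bool" where
  "Cantor_system X T \<longleftrightarrow> topological_dynamical_system X T \<and> Cantor_space X"

definition orbit_on :: "'a set \<Rightarrow> ('a \<Rightarrow> 'a) \<Rightarrow> 'a \<Rightarrow> 'a set" where
  "orbit_on X T x =
     range (\<lambda>n::nat. (T ^^ n) x) \<union> range (\<lambda>n::nat. (inv_into X T ^^ n) x)"

definition minimal_system :: "'a::metric_space set \<Rightarrow> ('a \<Rightarrow> 'a) \<Rightarrow> bool" where
  "minimal_system X T \<longleftrightarrow>
     topological_dynamical_system X T \<and> (\<forall>x\<in>X. X \<subseteq> closure (orbit_on X T x))"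

text \<open>
  Invariance is \<open>T ` Z = Z\<close>, so that the restriction of \<open>T\<close> to \<open>Z\<close> is again a homeomorphism.
\<close>

definition subsystem :: "'a::metric_space set \<Rightarrow> 'a set \<Rightarrow> ('a \<Rightarrow> 'a) \<Rightarrow> bool" where
  "subsystem Z X T \<longleftrightarrow> Z \<noteq> {} \<and> closedin (top_of_set X) Z \<and> T ` Z = Z"

definition essentially_minimal :: "'a::metric_space set \<Rightarrow> ('a \<Rightarrow> 'a) \<Rightarrow> bool" where
  "essentially_minimal X T \<longleftrightarrow>
     topological_dynamical_system X T \<and> (\<exists>!Z. subsystem Z X T \<and> minimal_system Z T)"

text \<open>
  A Kakutani-Rokhlin partition is given by its towers: a pair \<open>(B, h)\<close> stands for the tower
  \<open>{T\<^sup>j B : 0 \<le> j < h}\<close>. The injectivity condition says that different indices yield different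
  members of the partition; hence the number of towers is the cardinality of the set of pairs.
\<close>

definition tower_index :: "('a set \<times> nat) set \<Rightarrow> (('a set \<times> nat) \<times> nat) set" where
  "tower_index K = (SIGMA t:K. {..<snd t})"

definition tower_level :: "('a \<Rightarrow> 'a) \<Rightarrow> ('a set \<times> nat) \<times> nat \<Rightarrow> 'a set" where
  "tower_level T = (\<lambda>((B, h), j). (T ^^ j) ` B)"

definition KR_cells :: "('a \<Rightarrow> 'a) \<Rightarrow> ('a set \<times> nat) set \<Rightarrow> 'a set set" where
  "KR_cells T K = tower_level T ` tower_index K"

definition KR_base :: "('a set \<times> nat) set \<Rightarrow> 'a set" where
  "KR_base K = (\<Union>(B, h)\<in>K. B)"

definition KR_partition ::
    "'a::metric_space set \<Rightarrow> ('a \<Rightarrow> 'a) \<Rightarrow> ('a set \<times> nat) set \<Rightarrow> bool" where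
  "KR_partition X T K \<longleftrightarrow>
     finite K \<and> (\<forall>(B, h)\<in>K. h \<ge> 1) \<and>
     inj_on (tower_level T) (tower_index K) \<and>
     partition_on X (KR_cells T K) \<and>
     (\<forall>C\<in>KR_cells T K. openin (top_of_set X) C \<and> closedin (top_of_set X) C)"

definition KR_realization ::
    "'a::metric_space set \<Rightarrow> ('a \<Rightarrow> 'a) \<Rightarrow> (nat \<Rightarrow> ('a set \<times> nat) set) \<Rightarrow> bool" where
  "KR_realization X T K \<longleftrightarrow>
     (\<forall>n. KR_partition X T (K n)) \<and>
     (\<forall>n. \<forall>C\<in>KR_cells T (K (Suc n)). \<exists>D\<in>KR_cells T (K n). C \<subseteq> D) \<and>
     (\<forall>n. KR_base (K (Suc n)) \<subseteq> KR_base (K n)) \<and>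
     (\<exists>x. (\<Inter>n. KR_base (K n)) = {x}) \<and>
     topology_generated_by (\<Union>n. KR_cells T (K n)) = top_of_set X"

text \<open>
  The supremum is \<open>\<infinity>\<close> for an unbounded number of towers and the maximum otherwise; the infimum is
  attained unless there is no realization, in which case it is \<open>\<infinity>\<close>.
\<close>

definition max_towers :: "(nat \<Rightarrow> ('a set \<times> nat) set) \<Rightarrow> enat" where
  "max_towers K = (SUP n. enat (card (K n)))"

definition finite_topological_rank :: "'a::metric_space set \<Rightarrow> ('a \<Rightarrow> 'a) \<Rightarrow> bool" where
  "finite_topological_rank X T \<longleftrightarrow> (\<exists>K. KR_realization X T K \<and> max_towers K < \<infinity>)"

definition topological_rank :: "'a::metric_space set \<Rightarrow> ('a \<Rightarrow> 'a) \<Rightarrow> enat" where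
  "topological_rank X T = Inf {max_towers K | K. KR_realization X T K}"

end

theory Submission
  imports Defs
begin

text \<open>
  Fix a clopen partition \<open>p\<close> of \<open>Y\<close>. For a fine Kakutani-Rokhlin partition of \<open>X\<close> with \<open>r\<close> towers, every
  \<open>p\<close>-itinerary in \<open>Y\<close> is a concatenation of \<open>r\<close> words \<open>w\<^sub>1, \<dots>, w\<^sub>r\<close>, but several points over the same
  \<open>y\<close> may cut it differently. Unless all itineraries are periodic (one tower suffices then), a point
  with lexicographically maximal itinerary has no factor of length \<open>d > 0\<close> ending at time \<open>0\<close> that
  is repeated immediately after time \<open>0\<close>. Hence over a small clopen neighbourhood \<open>C\<close> of it, a word \<open>w\<^sub>i\<close>
  straddling time \<open>0\<close> does so at an offset depending on \<open>i\<close> only. Choose one point over each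
  return word of \<open>C\<close> and add its cuts to \<open>C\<close>: the return words of the resulting clopen set are
  the \<open>w\<^sub>i\<close> and the two parts into which the offset splits them, at most \<open>3 r\<close> in all.
\<close>

section \<open>Clopen sets\<close>

text \<open>A base \<open>V\<close> grouped by return words turns a bound on words into a bound on
  towers. Bases must also nest and shrink to a point, so \<open>V\<close> has to lie in a prescribed
  small clopen set. That set receives the largest label \<open>M\<close>: a maximal itinerary then
  starts inside it. The cuts added to \<open>C\<close> must fall into it as well, which is arranged
  by composing \<alpha> with a power of \<open>S\<close>. A cut belongs to a point of
  \<open>X\<close>, so the cuts alone define no clopen subset of \<open>Y\<close>. The visits to
  \<open>C\<close> are visible in \<open>Y\<close>; they permit a fresh choice of a point of
  \<open>X\<close> at each visit. The price is that the word in progress at a visit is broken off,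
  and another one is entered midway. Since the place of the break depends on the word only, each
  word contributes itself, one prefix and one suffix, whence the factor 3.\<close>

definition clopen_in :: "'a::metric_space set \<Rightarrow> 'a set \<Rightarrow> bool" where
  "clopen_in Y A \<longleftrightarrow> openin (top_of_set Y) A \<and> closedin (top_of_set Y) A"

lemma clopen_in_subset: "clopen_in Y A \<Longrightarrow> A \<subseteq> Y"
  using closedin_imp_subset by (auto simp: clopen_in_def)

lemma clopen_in_self: "clopen_in Y Y"
  by (simp add: clopen_in_def)

lemma clopen_in_Int: "clopen_in Y A \<Longrightarrow> clopen_in Y B \<Longrightarrow> clopen_in Y (A \<inter> B)"
  by (auto simp: clopen_in_def)

lemma clopen_in_Un: "clopen_in Y A \<Longrightarrow> clopen_in Y B \<Longrightarrow> clopen_in Y (A \<union> B)"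
  by (auto simp: clopen_in_def)

lemma clopen_in_Diff: "clopen_in Y A \<Longrightarrow> clopen_in Y B \<Longrightarrow> clopen_in Y (A - B)"
  by (auto simp: clopen_in_def)

lemma clopen_in_UN:
  assumes "finite I" "\<And>i. i \<in> I \<Longrightarrow> clopen_in Y (A i)"
  shows "clopen_in Y (\<Union>i\<in>I. A i)"
  using assms unfolding clopen_in_def by (auto intro!: closedin_Union)

lemma clopen_in_Collect_const: "clopen_in Y {y\<in>Y. c}"
  by (cases c) (auto simp: clopen_in_def)

lemma clopen_in_Collect_conj:
  assumes "clopen_in Y {y\<in>Y. P y}" "clopen_in Y {y\<in>Y. Q y}"
  shows "clopen_in Y {y\<in>Y. P y \<and> Q y}"
proof -
  have "{y\<in>Y. P y \<and> Q y} = {y\<in>Y. P y} \<inter> {y\<in>Y. Q y}" by auto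
  then show ?thesis using assms clopen_in_Int by metis
qed

lemma clopen_in_Collect_not:
  assumes "clopen_in Y {y\<in>Y. P y}"
  shows "clopen_in Y {y\<in>Y. \<not> P y}"
proof -
  have "{y\<in>Y. \<not> P y} = Y - {y\<in>Y. P y}" by auto
  then show ?thesis using assms clopen_in_Diff clopen_in_self by metis
qed

lemma clopen_in_Collect_ball:
  assumes "finite I" "\<And>i. i \<in> I \<Longrightarrow> clopen_in Y {y\<in>Y. P i y}"
  shows "clopen_in Y {y\<in>Y. \<forall>i\<in>I. P i y}"
  using assms
proof (induction I rule: finite_induct)
  case empty
  then show ?case by (simp add: clopen_in_self)
next
  case (insert i I)
  then have "clopen_in Y {y\<in>Y. P i y \<and> (\<forall>i\<in>I. P i y)}"
    by (intro clopen_in_Collect_conj) auto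
  then show ?case by simp
qed

text \<open>In a compact Hausdorff space components and quasi-components coincide, so the component
  \<open>{y}\<close> is separated by a clopen set from the compact set \<open>Y - G\<close>.\<close>

lemma clopen_in_nbhd:
  fixes Y :: "'a::metric_space set"
  assumes "compact Y" "totally_disconnected Y" "y \<in> Y" "open G" "y \<in> G"
  obtains A where "clopen_in Y A" "y \<in> A" "A \<subseteq> G"
proof -
  let ?T = "top_of_set Y"
  have cs: "connected_component_of_set ?T y = connected_component_set Y y"
    by (auto simp: connected_component_of_def connected_component_def connectedin_subtopology)
  have "connected_component_of_set ?T y = {y}"
    using assms by (simp add: cs totally_disconnected_def)
  then have "{y} \<in> connected_components_of ?T"
    using \<open>y \<in> Y\<close> by (force simp: connected_components_of_def)
  moreover have "locally_compact_space ?T"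
    by (simp add: assms(1) compact_imp_locally_compact_space compact_space_subtopology)
  moreover have "Hausdorff_space ?T"
    by (simp add: Hausdorff_space_subtopology)
  moreover have "compactin ?T {y}"
    using \<open>y \<in> Y\<close> by simp
  ultimately have q: "{y} \<in> quasi_components_of ?T"
    using compact_quasi_eq_connected_components_of by blast
  have "compactin ?T (Y - G)"
    using assms by (simp add: compactin_subtopology compact_diff)
  then have "separated_between ?T {y} (Y - G)"
    using q \<open>y \<in> G\<close> separated_between_quasi_component_compact
    by (metis Diff_iff disjnt_insert1 disjnt_empty1)
  then obtain U V where UV: "openin ?T U" "openin ?T V" "U \<union> V = Y" "disjnt U V" "y \<in> U" "Y - G \<subseteq> V"
    unfolding separated_between_def by auto
  have "U = Y - V"
    using UV by (auto simp: disjnt_iff)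
  then have "closedin ?T U"
    using UV by auto
  with UV have "clopen_in Y U" by (simp add: clopen_in_def)
  moreover have "U \<subseteq> G"
    using UV \<open>U = Y - V\<close> by auto
  ultimately show thesis
    using that \<open>y \<in> U\<close> by blast
qed

section \<open>Dynamical systems\<close>

locale dynamical_system =
  fixes Y :: "'b::metric_space set" and S :: "'b \<Rightarrow> 'b"
  assumes tds: "topological_dynamical_system Y S"
begin

lemma nonempty: "Y \<noteq> {}" and compact_space: "compact Y" and cont: "continuous_on Y S"
  and image: "S ` Y = Y" and inj: "inj_on S Y"
  using tds unfolding topological_dynamical_system_def homeomorphism_def
  by (auto intro: inj_on_inverseI)

lemma funpow_in: "y \<in> Y \<Longrightarrow> (S ^^ n) y \<in> Y"
  using image by (induction n) auto

lemma funpow_image: "(S ^^ n) ` Y = Y"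
proof (induction n)
  case (Suc n)
  have "(S ^^ Suc n) ` Y = S ` ((S ^^ n) ` Y)" by (simp add: image_image)
  then show ?case by (simp only: Suc.IH image)
qed simp

lemma funpow_inj_on: "inj_on (S ^^ n) Y"
proof (induction n)
  case (Suc n)
  then have "inj_on (S \<circ> (S ^^ n)) Y"
    by (intro comp_inj_on) (simp_all add: funpow_image inj)
  then show ?case by (simp add: comp_def)
qed simp

lemma funpow_cancel:
  assumes "y \<in> Y" "z \<in> Y" "(S ^^ j) y = (S ^^ k) z" "j \<le> k"
  shows "y = (S ^^ (k - j)) z"
proof -
  have "(S ^^ j) y = (S ^^ j) ((S ^^ (k - j)) z)"
    using assms(3,4) by (simp flip: funpow_add[unfolded comp_def, THEN fun_cong])
  then show ?thesis
    using funpow_inj_on assms(1,2) funpow_in by (meson inj_onD)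
qed

lemma funpow_cont: "continuous_on Y (S ^^ n)"
proof (induction n)
  case (Suc n)
  then have "continuous_on Y (S \<circ> (S ^^ n))"
    by (intro continuous_on_compose) (simp_all add: funpow_image cont)
  then show ?case by simp
qed simp

lemma preimage:
  assumes "y \<in> Y"
  obtains z where "z \<in> Y" "(S ^^ n) z = y"
  using assms funpow_image[of n] by (metis imageE)

lemma clopen_in_vimage:
  assumes "clopen_in Y {y\<in>Y. P y}"
  shows "clopen_in Y {y\<in>Y. P ((S ^^ n) y)}"
proof -
  have eq: "{y\<in>Y. P ((S ^^ n) y)} = Y \<inter> (S ^^ n) -` {y\<in>Y. P y}"
    using funpow_in by auto
  have "(S ^^ n) \<in> Y \<rightarrow> Y"
    using funpow_in by auto
  then show ?thesis
    using assms continuous_openin_preimage[OF funpow_cont] continuous_closedin_preimage_gen[OF funpow_cont]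
    unfolding clopen_in_def eq by blast
qed

text \<open>Closed images are closed by compactness; openness follows by passing to complements, as
  \<open>S ^^ n\<close> permutes \<open>Y\<close>.\<close>

lemma clopen_in_image:
  assumes "clopen_in Y A"
  shows "clopen_in Y ((S ^^ n) ` A)"
proof -
  have AY: "A \<subseteq> Y" using assms clopen_in_subset by auto
  have cl: "closedin (top_of_set Y) ((S ^^ n) ` B)" if "closedin (top_of_set Y) B" for B
  proof -
    have "compact B" "B \<subseteq> Y"
      using that compact_space closedin_compact_eq by auto
    then have "compact ((S ^^ n) ` B)"
      using compact_continuous_image funpow_cont continuous_on_subset by metis
    then show ?thesis
      using \<open>B \<subseteq> Y\<close> funpow_in by (intro closed_subset) (auto intro: compact_imp_closed)
  qed
  have "(S ^^ n) ` A = Y - (S ^^ n) ` (Y - A)"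
    using AY funpow_inj_on[of n] funpow_image[of n] inj_on_image_set_diff[of "S ^^ n" Y Y "Y - A"]
    by (metis Diff_Diff_Int Diff_subset inf.absorb2 inj_on_image_set_diff order_refl)
  moreover have "closedin (top_of_set Y) ((S ^^ n) ` (Y - A))"
    by (rule cl) (use assms in \<open>auto simp: clopen_in_def\<close>)
  ultimately show ?thesis
    using assms cl unfolding clopen_in_def by (metis openin_diff openin_subtopology_self)
qed

end

section \<open>Minimal systems and uniform recurrence\<close>

locale minimal_dynamical_system =
  fixes Y :: "'b::metric_space set" and S :: "'b \<Rightarrow> 'b"
  assumes minimal: "minimal_system Y S"

sublocale minimal_dynamical_system \<subseteq> dynamical_system
  using minimal by unfold_locales (simp add: minimal_system_def)

context minimal_dynamical_system
begin

lemma funpow_inv: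
  assumes "y \<in> Y"
  shows "(inv_into Y S ^^ n) y \<in> Y" "(S ^^ n) ((inv_into Y S ^^ n) y) = y"
proof (induction n)
  case (Suc n)
  have "(S ^^ Suc n) ((inv_into Y S ^^ Suc n) y)
      = (S ^^ n) (S (inv_into Y S ((inv_into Y S ^^ n) y)))"
    by (simp add: funpow_swap1)
  then show "(S ^^ Suc n) ((inv_into Y S ^^ Suc n) y) = y"
    using Suc image by (simp add: f_inv_into_f)
  show "(inv_into Y S ^^ Suc n) y \<in> Y"
    using Suc image by (simp add: inv_into_into)
qed (use assms in auto)

text \<open>The orbit is two-sided, so density only gives a visit in the future or in the past; the
  latter is phrased with a forward iterate to keep the inverse map out of later proofs.\<close>

lemma orbit_visits:
  assumes "y \<in> Y" "clopen_in Y A" "A \<noteq> {}"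
  obtains n where "(S ^^ n) y \<in> A \<or> (\<exists>z\<in>A. y = (S ^^ n) z)"
proof -
  obtain G where G: "open G" "A = Y \<inter> G"
    using assms by (auto simp: clopen_in_def openin_open)
  obtain a where a: "a \<in> A" using assms by auto
  have "a \<in> closure (orbit_on Y S y)"
    using minimal a G assms by (auto simp: minimal_system_def)
  then have "orbit_on Y S y \<inter> G \<noteq> {}"
    using G a by (meson IntD2 closure_iff_nhds_not_empty open_contains_ball subset_refl)
  then obtain n where "(S ^^ n) y \<in> G \<or> (inv_into Y S ^^ n) y \<in> G"
    by (auto simp: orbit_on_def)
  then have "(S ^^ n) y \<in> A \<or> (inv_into Y S ^^ n) y \<in> A"
    using G funpow_in[OF assms(1), of n] funpow_inv[OF assms(1), of n] by auto
  then show thesis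
    using that[of n] funpow_inv(2)[OF assms(1), of n] by metis
qed

text \<open>Compactness makes two-sided visits one-sided: finitely many \<open>D i\<close> with
  \<open>i \<le> N\<close> cover \<open>Y\<close>, and a visit at most \<open>N\<close> steps before
  or after \<open>(S ^^ N) y\<close> is a forward visit of \<open>y\<close> within
  \<open>2 * N\<close> steps.\<close>

lemma bounded_visits:
  assumes "clopen_in Y A" "A \<noteq> {}"
  obtains N where "\<And>y. y \<in> Y \<Longrightarrow> \<exists>k\<le>N. (S ^^ k) y \<in> A"
proof -
  define D where "D n = {y\<in>Y. (S ^^ n) y \<in> A} \<union> (S ^^ n) ` A" for n
  have AY: "{y\<in>Y. y \<in> A} = A" using clopen_in_subset[OF assms(1)] by auto
  have D: "openin (top_of_set Y) (D n)" for n
    using clopen_in_Un[OF clopen_in_vimage clopen_in_image, of "\<lambda>y. y \<in> A" A n] assms AY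
    by (auto simp: D_def clopen_in_def)
  have "Y \<subseteq> \<Union>(range D)"
  proof
    fix y assume "y \<in> Y"
    obtain n where n: "(S ^^ n) y \<in> A \<or> (\<exists>z\<in>A. y = (S ^^ n) z)"
      by (rule orbit_visits[OF \<open>y \<in> Y\<close> assms])
    have "y \<in> D n"
      unfolding D_def using n \<open>y \<in> Y\<close> by blast
    then show "y \<in> \<Union>(range D)" by auto
  qed
  moreover have "\<forall>c\<in>range D. openin (top_of_set Y) c"
    using D by auto
  ultimately obtain F where F: "F \<subseteq> range D" "finite F" "Y \<subseteq> \<Union>F"
    using compact_space[unfolded compact_eq_openin_cover, THEN spec, of "range D"] by auto
  obtain I where I: "finite I" "F = D ` I"
    using finite_subset_image[OF F(2,1)] by auto
  define N where "N = Max (insert 0 I)"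
  have N: "i \<le> N" if "i \<in> I" for i
    using that I by (simp add: N_def)
  have "\<exists>k\<le>2 * N. (S ^^ k) y \<in> A" if "y \<in> Y" for y
  proof -
    have "(S ^^ N) y \<in> Y" using that funpow_in by auto
    then obtain i where i: "i \<in> I" "(S ^^ N) y \<in> D i"
      using F I by auto
    then consider "(S ^^ i) ((S ^^ N) y) \<in> A" | z where "z \<in> A" "(S ^^ N) y = (S ^^ i) z"
      by (auto simp: D_def)
    then show ?thesis
    proof cases
      case 1
      then have "(S ^^ (i + N)) y \<in> A" by (simp add: funpow_add)
      then show ?thesis using N[OF i(1)] by (intro exI[of _ "i + N"]) simp
    next
      case 2
      then have "z = (S ^^ (N - i)) y"
        using that funpow_cancel[of z y i N] N[OF i(1)] clopen_in_subset[OF assms(1)] by auto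
      then show ?thesis using 2 N[OF i(1)] by (intro exI[of _ "N - i"]) simp
    qed
  qed
  then show thesis using that by blast
qed

end

section \<open>Return words\<close>

context minimal_dynamical_system
begin

text \<open>\<open>LEAST\<close> is unspecified if there is no return; for points of
  \<open>Y\<close> and nonempty clopen \<open>V\<close> a return exists by
  \<open>bounded_visits\<close>.\<close>

definition return_time :: "'b set \<Rightarrow> 'b \<Rightarrow> nat" where
  "return_time V y = (LEAST n. 0 < n \<and> (S ^^ n) y \<in> V)"

definition return_word :: "('b \<Rightarrow> 'c) \<Rightarrow> 'b set \<Rightarrow> 'b \<Rightarrow> 'c list" where
  "return_word p V y = map (\<lambda>j. p ((S ^^ j) y)) [0..<return_time V y]"

lemma length_return_word [simp]: "length (return_word p V y) = return_time V y"
  by (simp add: return_word_def)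

lemma nth_return_word: "j < return_time V y \<Longrightarrow> return_word p V y ! j = p ((S ^^ j) y)"
  by (simp add: return_word_def)

text \<open>Towers are indexed by words and not merely by return times, so that every level lies in
  a single fibre of \<open>p\<close>.\<close>

definition return_towers :: "('b \<Rightarrow> 'c) \<Rightarrow> 'b set \<Rightarrow> ('b set \<times> nat) set" where
  "return_towers p V = (\<lambda>u. ({v\<in>V. return_word p V v = u}, length u)) ` return_word p V ` V"

lemma return_time_le: "0 < n \<Longrightarrow> (S ^^ n) y \<in> V \<Longrightarrow> return_time V y \<le> n"
  unfolding return_time_def by (rule Least_le) simp

lemma return_time_eqI:
  assumes "0 < n" "(S ^^ n) y \<in> V" "\<And>j. 0 < j \<Longrightarrow> j < n \<Longrightarrow> (S ^^ j) y \<notin> V"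
  shows "return_time V y = n"
  unfolding return_time_def
proof (rule Least_equality)
  show "n \<le> m" if "0 < m \<and> (S ^^ m) y \<in> V" for m
    using assms(3)[of m] that by force
qed (use assms in simp)

lemma bounded_return_time:
  assumes "clopen_in Y V" "V \<noteq> {}"
  obtains N where "\<And>y. y \<in> Y \<Longrightarrow> return_time V y \<le> N"
    "\<And>y. y \<in> Y \<Longrightarrow> 0 < return_time V y \<and> (S ^^ return_time V y) y \<in> V"
proof -
  obtain N where N: "\<And>y. y \<in> Y \<Longrightarrow> \<exists>k\<le>N. (S ^^ k) y \<in> V"
    using bounded_visits[OF assms(1,2)] by blast
  \<comment> \<open>The bound is applied to \<open>S y\<close>, so that a visit at time 0 does not
    count as a return.\<close>
  have ex: "\<exists>n\<le>Suc N. 0 < n \<and> (S ^^ n) y \<in> V" if "y \<in> Y" for y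
  proof -
    obtain k where "k \<le> N" "(S ^^ k) (S y) \<in> V"
      using N[of "S y"] image \<open>y \<in> Y\<close> by blast
    then show ?thesis
      by (intro exI[of _ "Suc k"]) (simp add: funpow_swap1)
  qed
  show thesis
  proof
    fix y assume y: "y \<in> Y"
    show "return_time V y \<le> Suc N"
      using ex[OF y] return_time_le by (meson order_trans)
    show "0 < return_time V y \<and> (S ^^ return_time V y) y \<in> V"
      unfolding return_time_def using ex[OF y] LeastI_ex[of "\<lambda>n. 0 < n \<and> (S ^^ n) y \<in> V"] by blast
  qed
qed

lemma return_time_visit:
  assumes "clopen_in Y V" "V \<noteq> {}" "y \<in> Y"
  shows "0 < return_time V y" "(S ^^ return_time V y) y \<in> V"
proof -
  obtain N where "\<And>y. y \<in> Y \<Longrightarrow> 0 < return_time V y \<and> (S ^^ return_time V y) y \<in> V"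
    using bounded_return_time[OF assms(1,2)] by metis
  then show "0 < return_time V y" "(S ^^ return_time V y) y \<in> V" using assms(3) by auto
qed

lemma return_time_min:
  "0 < j \<Longrightarrow> j < return_time V y \<Longrightarrow> (S ^^ j) y \<notin> V"
  using return_time_le[of j y V] by auto

lemma return_towers_cover:
  assumes "clopen_in Y V" "V \<noteq> {}" "y \<in> Y"
  obtains v j where "v \<in> V" "j < return_time V v" "y = (S ^^ j) v"
proof -
  obtain N where N: "\<And>y. y \<in> Y \<Longrightarrow> \<exists>k\<le>N. (S ^^ k) y \<in> V"
    using bounded_visits[OF assms(1,2)] by blast
  obtain g where g: "g \<in> Y" "(S ^^ N) g = y"
    by (rule preimage[OF assms(3)])
  \<comment> \<open>Between \<open>g\<close> and \<open>y\<close> the orbit visits \<open>V\<close>,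
    by the choice of \<open>N\<close>; the last such visit is the base point below
    \<open>y\<close>.\<close>
  define I where "I = {k. k \<le> N \<and> (S ^^ k) g \<in> V}"
  have I: "finite I" "I \<noteq> {}"
    using N[OF g(1)] by (auto simp: I_def)
  define k where "k = Max I"
  have k: "k \<le> N" "(S ^^ k) g \<in> V"
    using Max_in[OF I] by (auto simp: k_def I_def)
  let ?v = "(S ^^ k) g"
  have "\<not> return_time V ?v \<le> N - k"
  proof
    assume le: "return_time V ?v \<le> N - k"
    have "?v \<in> Y" using g funpow_in by auto
    note r = return_time_visit[OF assms(1,2) this]
    have "return_time V ?v + k \<in> I"
      using le k r by (auto simp: I_def funpow_add)
    then have "return_time V ?v + k \<le> k"
      using Max_ge[OF I(1)] unfolding k_def by blast
    then show False using r by simp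
  qed
  moreover have "y = (S ^^ (N - k)) ?v"
    using g k by (simp flip: funpow_add[unfolded comp_def, THEN fun_cong])
  ultimately show thesis
    using that k by (metis not_le)
qed

text \<open>Cancelling the smaller iterate would otherwise exhibit a visit to \<open>V\<close>
  before the first return.\<close>

lemma return_towers_unique:
  assumes "V \<subseteq> Y" "v \<in> V" "v' \<in> V" "j < return_time V v" "j' < return_time V v'"
    and "(S ^^ j) v = (S ^^ j') v'"
  shows "v = v' \<and> j = j'"
proof -
  have *: "v = v' \<and> j = j'" if "v \<in> V" "v' \<in> V" "j' < return_time V v'"
    "(S ^^ j) v = (S ^^ j') v'" "j \<le> j'" for v v' j j'
  proof -
    have v: "v = (S ^^ (j' - j)) v'"
      using funpow_cancel[of v v' j j'] that \<open>V \<subseteq> Y\<close> by auto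
    then have "j' - j = 0"
      using return_time_min[of "j' - j" V v'] that by (metis diff_le_self le_less_trans neq0_conv)
    then show ?thesis using v that by simp
  qed
  show ?thesis
  proof (cases "j \<le> j'")
    case True
    then show ?thesis using * assms by blast
  next
    case False
    then show ?thesis using *[of v' v j j'] assms by auto
  qed
qed

text \<open>A prescribed return word is a conjunction of finitely many clopen conditions at times up
  to \<open>length u\<close>.\<close>

lemma clopen_in_return_word_fibre:
  assumes "clopen_in Y V" "V \<noteq> {}" and p: "\<And>a. clopen_in Y {y\<in>Y. p y = a}"
  shows "clopen_in Y {v\<in>V. return_word p V v = u}"
proof -
  let ?n = "length u"
  have VY: "V \<subseteq> Y" using assms clopen_in_subset by auto
  have "return_word p V v = u \<longleftrightarrow>
      0 < ?n \<and> (S ^^ ?n) v \<in> V \<and> (\<forall>j\<in>{0<..<?n}. \<not> (S ^^ j) v \<in> V) \<and>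
      (\<forall>j\<in>{..<?n}. p ((S ^^ j) v) = u ! j)" if "v \<in> V" for v
  proof -
    have "return_time V v = ?n \<longleftrightarrow> 0 < ?n \<and> (S ^^ ?n) v \<in> V \<and> (\<forall>j\<in>{0<..<?n}. \<not> (S ^^ j) v \<in> V)"
    proof
      assume "return_time V v = ?n"
      then show "0 < ?n \<and> (S ^^ ?n) v \<in> V \<and> (\<forall>j\<in>{0<..<?n}. \<not> (S ^^ j) v \<in> V)"
        using return_time_visit[OF assms(1,2)] return_time_min[of _ V v] that VY
        by (metis greaterThanLessThan_iff subsetD)
    next
      assume "0 < ?n \<and> (S ^^ ?n) v \<in> V \<and> (\<forall>j\<in>{0<..<?n}. \<not> (S ^^ j) v \<in> V)"
      then show "return_time V v = ?n" by (intro return_time_eqI) auto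
    qed
    moreover have "return_word p V v = u \<longleftrightarrow>
        return_time V v = ?n \<and> (\<forall>j\<in>{..<?n}. p ((S ^^ j) v) = u ! j)"
      by (auto simp: list_eq_iff_nth_eq nth_return_word)
    ultimately show ?thesis by blast
  qed
  then have "{v\<in>V. return_word p V v = u} = V \<inter> {v\<in>Y. 0 < ?n \<and> (S ^^ ?n) v \<in> V \<and>
      (\<forall>j\<in>{0<..<?n}. \<not> (S ^^ j) v \<in> V) \<and> (\<forall>j\<in>{..<?n}. p ((S ^^ j) v) = u ! j)}"
    using VY by auto
  moreover have "{y\<in>Y. y \<in> V} = V" using VY by auto
  then have "clopen_in Y {y\<in>Y. (S ^^ k) y \<in> V}" for k
    using clopen_in_vimage[of "\<lambda>y. y \<in> V" k] assms(1) by simp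
  ultimately show ?thesis
    using assms(1) clopen_in_vimage[OF p]
    by (simp only:) (intro clopen_in_Int clopen_in_Collect_conj clopen_in_Collect_const
      clopen_in_Collect_ball clopen_in_Collect_not finite_lessThan finite_greaterThanLessThan)
qed

lemma finite_return_words:
  assumes "clopen_in Y V" "V \<noteq> {}" "finite (p ` Y)"
  shows "finite (return_word p V ` V)"
proof -
  have VY: "V \<subseteq> Y" using assms clopen_in_subset by auto
  obtain N where N: "\<And>y. y \<in> Y \<Longrightarrow> return_time V y \<le> N"
    using bounded_return_time[OF assms(1,2)] by blast
  have "return_word p V ` V \<subseteq> {xs. set xs \<subseteq> p ` Y \<and> length xs \<le> N}"
    using VY N funpow_in by (fastforce simp: return_word_def)
  then show ?thesis
    using finite_lists_length_le[OF assms(3)] finite_subset by blast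
qed

text \<open>Level \<open>j\<close> of the tower of a word \<open>u\<close> carries the single letter
  \<open>u ! j\<close>, whence the last claim: the cells refine the partition into fibres of
  \<open>p\<close>.\<close>

lemma KR_partition_return_towers:
  assumes V: "clopen_in Y V" "V \<noteq> {}"
    and p: "finite (p ` Y)" "\<And>a. clopen_in Y {y\<in>Y. p y = a}"
  shows "KR_partition Y S (return_towers p V)"
    and "KR_base (return_towers p V) = V"
    and "card (return_towers p V) \<le> card (return_word p V ` V)"
    and "\<And>C x y. C \<in> KR_cells S (return_towers p V) \<Longrightarrow> x \<in> C \<Longrightarrow> y \<in> C \<Longrightarrow> p x = p y"
proof -
  let ?W = "return_word p V ` V"
  let ?B = "\<lambda>u. {v\<in>V. return_word p V v = u}"
  have VY: "V \<subseteq> Y" using V clopen_in_subset by auto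
  have fin: "finite ?W" by (rule finite_return_words[OF V p(1)])
  show "card (return_towers p V) \<le> card ?W"
    using fin by (auto simp: return_towers_def intro: card_image_le)
  show "KR_base (return_towers p V) = V"
    by (auto simp: KR_base_def return_towers_def)
  have index: "t \<in> tower_index (return_towers p V) \<longleftrightarrow>
      (\<exists>v\<in>V. \<exists>j<return_time V v. t = ((?B (return_word p V v), return_time V v), j))" for t
    unfolding tower_index_def return_towers_def by auto
  have level: "tower_level S ((?B u, n), j) = (S ^^ j) ` ?B u" for u n j
    by (simp add: tower_level_def)
  have cells: "C \<in> KR_cells S (return_towers p V) \<longleftrightarrow>
      (\<exists>v\<in>V. \<exists>j<return_time V v. C = (S ^^ j) ` ?B (return_word p V v))" for C
  proof
    assume "C \<in> KR_cells S (return_towers p V)"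
    then obtain t where t: "t \<in> tower_index (return_towers p V)" "C = tower_level S t"
      by (auto simp: KR_cells_def)
    then obtain v j where "v \<in> V" "j < return_time V v" "t = ((?B (return_word p V v), return_time V v), j)"
      unfolding index by blast
    moreover from this have "C = (S ^^ j) ` ?B (return_word p V v)"
      by (simp only: t(2) level)
    ultimately show "\<exists>v\<in>V. \<exists>j<return_time V v. C = (S ^^ j) ` ?B (return_word p V v)"
      by blast
  next
    assume "\<exists>v\<in>V. \<exists>j<return_time V v. C = (S ^^ j) ` ?B (return_word p V v)"
    then obtain v j where "v \<in> V" "j < return_time V v" "C = (S ^^ j) ` ?B (return_word p V v)"
      by blast
    then have "((?B (return_word p V v), return_time V v), j) \<in> tower_index (return_towers p V)"
      "C = tower_level S ((?B (return_word p V v), return_time V v), j)"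
      unfolding index level by blast+
    then show "C \<in> KR_cells S (return_towers p V)"
      unfolding KR_cells_def by (rule rev_image_eqI)
  qed
  have eqlen: "return_time V v = return_time V v'" if "return_word p V v = return_word p V v'" for v v'
    using that by (metis length_return_word)
  have same: "return_word p V v = return_word p V v' \<and> j = j'"
    if vv: "v \<in> V" "v' \<in> V" "j < return_time V v" "j' < return_time V v'"
      and y: "y \<in> (S ^^ j) ` ?B (return_word p V v)" "y \<in> (S ^^ j') ` ?B (return_word p V v')" for v v' j j' y
  proof -
    obtain w where w: "w \<in> V" "return_word p V w = return_word p V v" "y = (S ^^ j) w"
      using y(1) by blast
    obtain w' where w': "w' \<in> V" "return_word p V w' = return_word p V v'" "y = (S ^^ j') w'"
      using y(2) by blast
    have "w = w' \<and> j = j'"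
      using return_towers_unique[OF VY w(1) w'(1), of j j'] vv(3,4) eqlen[OF w(2)] eqlen[OF w'(2)]
        w(3) w'(3) by simp
    then show ?thesis using w w' by auto
  qed
  show const: "p x = p y"
    if C: "C \<in> KR_cells S (return_towers p V)" "x \<in> C" "y \<in> C" for C x y
  proof -
    obtain v j where v: "v \<in> V" "j < return_time V v" "C = (S ^^ j) ` ?B (return_word p V v)"
      using C cells by auto
    obtain x' where x': "x = (S ^^ j) x'" "return_word p V x' = return_word p V v"
      using C(2) v(3) by blast
    obtain y' where y': "y = (S ^^ j) y'" "return_word p V y' = return_word p V v"
      using C(3) v(3) by blast
    show ?thesis
      using nth_return_word[of j V x' p] nth_return_word[of j V y' p] v(2) x' y'
        eqlen[OF x'(2)] eqlen[OF y'(2)] by simp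
  qed
  show "KR_partition Y S (return_towers p V)"
    unfolding KR_partition_def
  proof (intro conjI)
    show "finite (return_towers p V)" using fin by (simp add: return_towers_def)
    show "\<forall>(B, h)\<in>return_towers p V. 1 \<le> h"
    proof clarify
      fix B h assume "(B, h) \<in> return_towers p V"
      then obtain v where "v \<in> V" "h = return_time V v"
        by (auto simp: return_towers_def)
      then show "1 \<le> h"
        using return_time_visit(1)[OF V, of v] VY by auto
    qed
    show "inj_on (tower_level S) (tower_index (return_towers p V))"
    proof (rule inj_onI)
      fix s t assume "s \<in> tower_index (return_towers p V)" "t \<in> tower_index (return_towers p V)"
        and eq: "tower_level S s = tower_level S t"
      then obtain v j v' j' where v: "v \<in> V" "j < return_time V v" "s = ((?B (return_word p V v), return_time V v), j)"
        "v' \<in> V" "j' < return_time V v'" "t = ((?B (return_word p V v'), return_time V v'), j')"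
        unfolding index by blast
      have in1: "(S ^^ j) v \<in> (S ^^ j) ` ?B (return_word p V v)" using v(1) by blast
      have "(S ^^ j) ` ?B (return_word p V v) = (S ^^ j') ` ?B (return_word p V v')"
        using eq unfolding v(3,6) level .
      then have "return_word p V v = return_word p V v' \<and> j = j'"
        using same[OF v(1,4,2,5) in1] in1 by simp
      then show "s = t" using v eqlen[of v v'] by simp
    qed
    show "partition_on Y (KR_cells S (return_towers p V))"
    proof (rule partition_onI)
      show "\<Union>(KR_cells S (return_towers p V)) = Y"
      proof (intro equalityI subsetI)
        fix y assume "y \<in> \<Union>(KR_cells S (return_towers p V))"
        then obtain v j where "v \<in> V" "y = (S ^^ j) v" unfolding Union_iff Bex_def cells by blast
        then show "y \<in> Y" using VY funpow_in by blast
      next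
        fix y assume "y \<in> Y"
        then obtain v j where "v \<in> V" "j < return_time V v" "y = (S ^^ j) v"
          using return_towers_cover[OF V] by metis
        then show "y \<in> \<Union>(KR_cells S (return_towers p V))"
          unfolding Union_iff Bex_def cells by blast
      qed
      show "disjnt C D" if "C \<in> KR_cells S (return_towers p V)" "D \<in> KR_cells S (return_towers p V)" "C \<noteq> D" for C D
      proof (rule ccontr)
        assume "\<not> disjnt C D"
        then obtain y where y: "y \<in> C" "y \<in> D" by (auto simp: disjnt_iff)
        obtain v j where v: "v \<in> V" "j < return_time V v" "C = (S ^^ j) ` ?B (return_word p V v)"
          using \<open>C \<in> _\<close> unfolding cells by blast
        obtain v' j' where v': "v' \<in> V" "j' < return_time V v'" "D = (S ^^ j') ` ?B (return_word p V v')"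
          using \<open>D \<in> _\<close> unfolding cells by blast
        have "return_word p V v = return_word p V v' \<and> j = j'"
          using same[of v v' j j' y] v v' y by blast
        then show False
          using v v' \<open>C \<noteq> D\<close> by simp
      qed
      show "{} \<notin> KR_cells S (return_towers p V)"
        by (auto simp: cells)
    qed
    show "\<forall>C\<in>KR_cells S (return_towers p V). openin (top_of_set Y) C \<and> closedin (top_of_set Y) C"
      using clopen_in_image[OF clopen_in_return_word_fibre[OF V p(2)]]
      by (auto simp: cells clopen_in_def)
  qed
qed

end

lemma compact_decseq_Inter_nonempty:
  fixes A :: "nat \<Rightarrow> 'a::metric_space set"
  assumes "compact Y" "\<And>n. closedin (top_of_set Y) (A n)" "\<And>n. A n \<noteq> {}" "decseq A"
  shows "(\<Inter>n. A n) \<noteq> {}"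
proof -
  have AY: "A n \<subseteq> Y" "closed (A n)" for n
    using assms(2)[of n] assms(1) closedin_imp_subset closedin_compact compact_imp_closed by blast+
  have "Y \<inter> (\<Inter>n\<in>UNIV. A n) \<noteq> {}"
  proof (rule compact_imp_fip_image[OF assms(1)])
    fix I :: "nat set" assume "finite I"
    then have "A (Max (insert 0 I)) \<subseteq> A n" if "n \<in> I" for n
      using that by (intro decseqD[OF assms(4)] Max_ge) auto
    then have "A (Max (insert 0 I)) \<subseteq> Y \<inter> (\<Inter>n\<in>I. A n)"
      using AY(1) by blast
    then show "Y \<inter> (\<Inter>n\<in>I. A n) \<noteq> {}"
      using assms(3) by blast
  qed (rule AY)
  then show ?thesis by auto
qed

section \<open>Kakutani-Rokhlin partitions\<close>

context dynamical_system
begin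

lemma KR_partition_cover:
  assumes "KR_partition Y S K" "y \<in> Y"
  obtains B h b i where "(B, h) \<in> K" "b \<in> B" "i < h" "y = (S ^^ i) b"
proof -
  have "y \<in> \<Union>(KR_cells S K)"
    using assms by (simp add: KR_partition_def partition_on_def)
  then show thesis
    using that by (auto simp: KR_cells_def tower_index_def tower_level_def)
qed

lemma KR_cells_iff:
  "C \<in> KR_cells S K \<longleftrightarrow> (\<exists>B h i. (B, h) \<in> K \<and> i < h \<and> C = (S ^^ i) ` B)"
proof
  assume "C \<in> KR_cells S K"
  then show "\<exists>B h i. (B, h) \<in> K \<and> i < h \<and> C = (S ^^ i) ` B"
    by (fastforce simp: KR_cells_def tower_index_def tower_level_def)
next
  assume "\<exists>B h i. (B, h) \<in> K \<and> i < h \<and> C = (S ^^ i) ` B"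
  then obtain B h i where "(B, h) \<in> K" "i < h" "C = (S ^^ i) ` B" by blast
  then have "((B, h), i) \<in> tower_index K" "C = tower_level S ((B, h), i)"
    by (auto simp: tower_index_def tower_level_def)
  then show "C \<in> KR_cells S K" unfolding KR_cells_def by (rule rev_image_eqI)
qed

lemma KR_partition_unique:
  assumes "KR_partition Y S K" "(B, h) \<in> K" "(B', h') \<in> K" "i < h" "i' < h'" "b \<in> B" "b' \<in> B'"
    and eq: "(S ^^ i) b = (S ^^ i') b'"
  shows "B = B'" "h = h'" "i = i'"
proof -
  let ?s = "((B, h), i)" and ?t = "((B', h'), i')"
  have index: "?s \<in> tower_index K" "?t \<in> tower_index K"
    using assms by (auto simp: tower_index_def)
  have "(S ^^ i) b \<in> tower_level S ?s" "(S ^^ i') b' \<in> tower_level S ?t"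
    using assms(6,7) by (auto simp: tower_level_def)
  then have "(S ^^ i) b \<in> tower_level S ?s" "(S ^^ i) b \<in> tower_level S ?t"
    by (simp_all only: eq)
  moreover have "tower_level S ?s \<in> KR_cells S K" "tower_level S ?t \<in> KR_cells S K"
    using index by (auto simp: KR_cells_def)
  moreover have "disjoint (KR_cells S K)"
    using assms(1) by (simp add: KR_partition_def partition_on_def)
  ultimately have "tower_level S ?s = tower_level S ?t"
    by (metis disjointD disjoint_iff)
  moreover have "inj_on (tower_level S) (tower_index K)"
    using assms(1) by (simp add: KR_partition_def)
  ultimately have "?s = ?t"
    using index inj_onD by metis
  then show "B = B'" "h = h'" "i = i'" by auto
qed

lemma KR_partition_base_subset:
  assumes "KR_partition Y S K" "(B, h) \<in> K"
  shows "B \<subseteq> Y" "B \<noteq> {}" "0 < h" "B \<in> KR_cells S K"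
proof -
  have p: "partition_on Y (KR_cells S K)"
    using assms(1) by (simp add: KR_partition_def)
  show h: "0 < h" using assms by (auto simp: KR_partition_def)
  then show "B \<in> KR_cells S K"
    unfolding KR_cells_iff using assms(2) by (intro exI[of _ B] exI[of _ h] exI[of _ 0]) simp
  then show "B \<subseteq> Y" "B \<noteq> {}"
    using p unfolding partition_on_def by auto
qed

text \<open>If \<open>(S ^^ h) b\<close> were at a level \<open>i' > 0\<close>, injectivity one step
  back would identify level \<open>h - 1\<close> with level \<open>i' - 1\<close> of the same tower,
  so that \<open>i' = h\<close> would be out of range.\<close>

lemma KR_partition_top:
  assumes K: "KR_partition Y S K" "(B, h) \<in> K" "b \<in> B"
  shows "(S ^^ h) b \<in> KR_base K"
proof -
  have bY: "b \<in> Y" using KR_partition_base_subset(1)[OF K(1,2)] K(3) by blast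
  then have "(S ^^ h) b \<in> Y" by (rule funpow_in)
  then obtain B' h' b' i' where b': "(B', h') \<in> K" "b' \<in> B'" "i' < h'" "(S ^^ h) b = (S ^^ i') b'"
    using KR_partition_cover[OF K(1)] by metis
  have b'Y: "b' \<in> Y" using KR_partition_base_subset(1)[OF K(1) b'(1)] b'(2) by blast
  have "h > 0" by (rule KR_partition_base_subset(3)[OF K(1,2)])
  have "i' = 0"
  proof (rule ccontr)
    assume "i' \<noteq> 0"
    then obtain i where i: "i' = Suc i" by (cases i') auto
    obtain k where k: "h = Suc k" using \<open>h > 0\<close> by (cases h) auto
    have "(S ^^ k) b = (S ^^ i) b'"
      using b'(4) unfolding i k funpow.simps comp_def
      using inj_onD[OF inj _ funpow_in[OF bY] funpow_in[OF b'Y]] by blast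
    then have "h = h'" "k = i"
      using KR_partition_unique(2,3)[OF K(1,2) b'(1) _ _ K(3) b'(2), of k i] i k b'(3) by simp_all
    then show False using i k b'(3) by simp
  qed
  then show ?thesis using b' by (auto simp: KR_base_def)
qed

text \<open>Together with \<open>KR_partition_top\<close>, the visits to \<open>KR_base K\<close>
  are exactly the times at which an orbit enters a tower from below.\<close>

lemma KR_partition_not_base:
  assumes K: "KR_partition Y S K" "(B, h) \<in> K" "b \<in> B" and i: "0 < i" "i < h"
  shows "(S ^^ i) b \<notin> KR_base K"
proof
  assume "(S ^^ i) b \<in> KR_base K"
  then obtain B' h' where B': "(B', h') \<in> K" "(S ^^ i) b \<in> B'"
    by (auto simp: KR_base_def)
  have "0 < h'" by (rule KR_partition_base_subset(3)[OF K(1) B'(1)])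
  then have "i = 0"
    using KR_partition_unique(3)[OF K(1,2) B'(1) i(2) _ K(3) B'(2), of 0] by simp
  then show False using i by simp
qed

end

context minimal_dynamical_system
begin

section \<open>Lexicographically maximal itineraries\<close>

text \<open>Maximality of the forward itinerary in the lexicographic order, unfolded letter by
  letter so that no order on infinite sequences is needed.\<close>

definition lex_maximal :: "('b \<Rightarrow> nat) \<Rightarrow> 'b \<Rightarrow> bool" where
  "lex_maximal p y \<longleftrightarrow> y \<in> Y \<and>
     (\<forall>z\<in>Y. \<forall>k. (\<forall>j<k. p ((S ^^ j) z) = p ((S ^^ j) y)) \<longrightarrow> p ((S ^^ k) z) \<le> p ((S ^^ k) y))"

lemma lex_maximal_exists:
  fixes p :: "'b \<Rightarrow> nat"
  assumes p: "finite (p ` Y)" "\<And>a. clopen_in Y {y\<in>Y. p y = a}"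
  obtains y where "lex_maximal p y"
proof -
  \<comment> \<open>\<open>M k\<close> consists of the points whose first \<open>k\<close> letters
    are chosen greedily as large as possible; compactness then gives a point that is optimal for all
    \<open>k\<close>.\<close>
  define M where "M = rec_nat Y (\<lambda>k A. {y\<in>A. p ((S ^^ k) y) = Max ((\<lambda>y. p ((S ^^ k) y)) ` A)})"
  have M0: "M 0 = Y" and MS: "M (Suc k) = {y\<in>M k. p ((S ^^ k) y) = Max ((\<lambda>y. p ((S ^^ k) y)) ` M k)}" for k
    by (simp_all add: M_def)
  have fin: "finite ((\<lambda>y. p ((S ^^ k) y)) ` A)" if "A \<subseteq> Y" for A k
    by (rule finite_subset[OF _ p(1)]) (use that funpow_in in auto)
  have M: "clopen_in Y (M k) \<and> M k \<noteq> {}" for k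
  proof (induction k)
    case 0
    then show ?case using M0 nonempty clopen_in_self by simp
  next
    case (Suc k)
    then have MY: "M k \<subseteq> Y" using clopen_in_subset by auto
    have "M (Suc k) = M k \<inter> {y\<in>Y. p ((S ^^ k) y) = Max ((\<lambda>y. p ((S ^^ k) y)) ` M k)}"
      using MY by (auto simp: MS)
    then have "clopen_in Y (M (Suc k))"
      using Suc clopen_in_Int[OF _ clopen_in_vimage[OF p(2)]] by simp
    moreover have "Max ((\<lambda>y. p ((S ^^ k) y)) ` M k) \<in> (\<lambda>y. p ((S ^^ k) y)) ` M k"
      using fin[OF MY] Suc by (intro Max_in) auto
    then have "M (Suc k) \<noteq> {}" by (auto simp: MS)
    ultimately show ?case by simp
  qed
  have dec: "M n \<subseteq> M m" if "m \<le> n" for m n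
    using that by (induction n rule: dec_induct) (auto simp: MS)
  have "(\<Inter>k. M k) \<noteq> {}"
    using M dec compact_space by (intro compact_decseq_Inter_nonempty) (auto simp: clopen_in_def decseq_def)
  then obtain y where y: "y \<in> M k" for k by blast
  have "lex_maximal p y"
    unfolding lex_maximal_def
  proof (intro conjI ballI allI impI)
    show "y \<in> Y" using y[of 0] M0 by simp
    fix z k assume z: "z \<in> Y" "\<forall>j<k. p ((S ^^ j) z) = p ((S ^^ j) y)"
    have "z \<in> M j" if "j \<le> k" for j
      using that
    proof (induction j)
      case (Suc j)
      then have "p ((S ^^ j) z) = p ((S ^^ j) y)" using z by auto
      then show ?case using Suc y[of "Suc j"] by (simp add: MS)
    qed (simp add: M0 z)
    then have "p ((S ^^ k) z) \<le> Max ((\<lambda>y. p ((S ^^ k) y)) ` M k)"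
      using M[of k] clopen_in_subset by (intro Max_ge fin) blast+
    then show "p ((S ^^ k) z) \<le> p ((S ^^ k) y)"
      using y[of "Suc k"] by (simp add: MS)
  qed
  then show thesis by (rule that)
qed

text \<open>Write the itinerary of \<open>y\<close> as u = w u' with w of length \<open>d\<close>;
  that of \<open>g\<close> is w u. Maximality gives u' \<le> u from the point
  \<open>(S ^^ d) y\<close> and w u \<le> w u' from \<open>g\<close>, hence u = u'. The induction
  carries this out letter by letter.\<close>

lemma lex_maximal_square_imp_periodic:
  assumes y: "lex_maximal p y" and g: "g \<in> Y" "(S ^^ d) g = y" "0 < d"
    and sq: "\<And>k. k < d \<Longrightarrow> p ((S ^^ k) g) = p ((S ^^ k) y)"
  shows "p ((S ^^ (k + d)) y) = p ((S ^^ k) y)"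
proof (induction k rule: less_induct)
  case (less k)
  have yY: "y \<in> Y" using y by (simp add: lex_maximal_def)
  have gd: "(S ^^ (j + d)) g = (S ^^ j) y" for j
    by (simp add: funpow_add g)
  have yd: "(S ^^ j) ((S ^^ d) y) = (S ^^ (j + d)) y" for j
    by (simp add: funpow_add)
  have "p ((S ^^ k) ((S ^^ d) y)) \<le> p ((S ^^ k) y)"
    using y less funpow_in[OF yY, of d] unfolding lex_maximal_def yd[symmetric] by blast
  \<comment> \<open>Below \<open>d\<close> the letters agree by \<open>sq\<close>, from
    \<open>d\<close> on by the induction hypothesis; so maximality applies to \<open>g\<close> at
    time \<open>k + d\<close>.\<close>
  moreover have "p ((S ^^ j) g) = p ((S ^^ j) y)" if "j < k + d" for j
  proof (cases "j < d")
    case False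
    then have "p ((S ^^ (j - d + d)) y) = p ((S ^^ (j - d)) y)"
      using that by (intro less) auto
    then show ?thesis using False gd[of "j - d"] by simp
  qed (rule sq)
  then have "p ((S ^^ (k + d)) g) \<le> p ((S ^^ (k + d)) y)"
    using y g(1) unfolding lex_maximal_def by blast
  ultimately show ?case
    using gd[of k] yd[of k] by simp
qed

text \<open>The clopen set \<open>D\<close> of points violating the period misses the forward orbit
  of \<open>y\<close>, so it is empty by minimality and every itinerary has period \<open>d\<close>.
  Then \<open>d\<close> letters determine the whole forward itinerary, and all points of
  \<open>V\<close> share one return word.\<close>

lemma periodic_return_word:
  assumes p: "finite (p ` Y)" "\<And>a. clopen_in Y {y\<in>Y. p y = a}"
    and y: "y \<in> Y" "0 < d" "\<And>k. p ((S ^^ (k + d)) y) = p ((S ^^ k) y)"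
  obtains V where "clopen_in Y V" "V \<noteq> {}" "\<And>v. v \<in> V \<Longrightarrow> p v = p y" "card (return_word p V ` V) = 1"
proof -
  \<comment> \<open>Inequality of two letters is spelled out over the finitely many values of
    \<open>p\<close>, which makes \<open>D\<close> visibly clopen.\<close>
  define D where "D = {z\<in>Y. \<forall>a\<in>p ` Y. \<not> (p ((S ^^ d) z) = a \<and> p ((S ^^ 0) z) = a)}"
  have D: "clopen_in Y D"
    unfolding D_def using p(1) clopen_in_vimage[OF p(2)]
    by (intro clopen_in_Collect_ball clopen_in_Collect_not clopen_in_Collect_conj)
  have notD: "(S ^^ k) y \<notin> D" for k
  proof -
    have "p ((S ^^ d) ((S ^^ k) y)) = p ((S ^^ k) y)"
      using y(3)[of k] by (simp flip: funpow_add[unfolded comp_def, THEN fun_cong] add: add.commute)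
    then show ?thesis using funpow_in[OF y(1), of k] by (auto simp: D_def)
  qed
  have "D = {}"
  proof (rule ccontr)
    assume "D \<noteq> {}"
    then obtain N where "\<And>z. z \<in> Y \<Longrightarrow> \<exists>k\<le>N. (S ^^ k) z \<in> D"
      using bounded_visits[OF D] by blast
    then show False using y(1) notD by blast
  qed
  then have per1: "p ((S ^^ d) z) = p z" if "z \<in> Y" for z
    using that by (auto simp: D_def)
  have per: "p ((S ^^ k) z) = p ((S ^^ (k mod d)) z)" if "z \<in> Y" for k z
  proof (induction k rule: less_induct)
    case (less k)
    show ?case
    proof (cases "k < d")
      case False
      have "p ((S ^^ k) z) = p ((S ^^ d) ((S ^^ (k - d)) z))"
        using False by (simp flip: funpow_add[unfolded comp_def, THEN fun_cong])
      also have "\<dots> = p ((S ^^ (k - d)) z)"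
        by (rule per1) (rule funpow_in[OF that])
      also have "\<dots> = p ((S ^^ ((k - d) mod d)) z)"
        using False y(2) by (intro less) auto
      finally show ?thesis using False by (simp add: le_mod_geq)
    qed simp
  qed
  define V where "V = {z\<in>Y. \<forall>k\<in>{..<d}. p ((S ^^ k) z) = p ((S ^^ k) y)}"
  have V: "clopen_in Y V"
    unfolding V_def using clopen_in_vimage[OF p(2)]
    by (intro clopen_in_Collect_ball) auto
  have yV: "y \<in> V" using y by (simp add: V_def)
  have same: "p ((S ^^ k) v) = p ((S ^^ k) y)" if "v \<in> V" for v k
    using that per[of v k] per[of y k] y mod_less_divisor[of d k] by (auto simp: V_def)
  have visit: "(S ^^ n) v \<in> V \<longleftrightarrow> (S ^^ n) y \<in> V" if "v \<in> V" for v n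
  proof -
    have "p ((S ^^ k) ((S ^^ n) v)) = p ((S ^^ k) ((S ^^ n) y))" for k
      using same[OF that, of "k + n"] by (simp add: funpow_add)
    moreover have "v \<in> Y" using that by (simp add: V_def)
    ultimately show ?thesis
      using funpow_in y(1) by (simp add: V_def)
  qed
  have "return_word p V v = return_word p V y" if "v \<in> V" for v
    unfolding return_word_def return_time_def visit[OF that] same[OF that] ..
  then have "return_word p V ` V = (\<lambda>_. return_word p V y) ` V"
    by (rule image_cong[OF refl])
  then have "return_word p V ` V = {return_word p V y}"
    using yV by (auto simp: image_constant_conv)
  then have "card (return_word p V ` V) = 1" by simp
  moreover have "p v = p y" if "v \<in> V" for v
    using same[OF that, of 0] by simp
  moreover have "V \<noteq> {}" using yV by blast
  ultimately show thesis
    using V that by blast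
qed

end

section \<open>A base with few return words\<close>

context minimal_dynamical_system
begin

text \<open>The argument \<open>\<kappa>\<close> gives, for each return word of \<open>C\<close>, the times at which it is cut.\<close>

definition refined_base :: "('b \<Rightarrow> 'c) \<Rightarrow> 'b set \<Rightarrow> ('c list \<Rightarrow> nat set) \<Rightarrow> 'b set" where
  "refined_base p C \<kappa> = {(S ^^ m) y | m y. y \<in> C \<and> m \<in> insert 0 (\<kappa> (return_word p C y))}"

lemma clopen_in_refined_base:
  assumes C: "clopen_in Y C" "C \<noteq> {}"
    and p: "finite (p ` Y)" "\<And>a. clopen_in Y {y\<in>Y. p y = a}"
    and \<kappa>: "\<And>c. \<kappa> c \<subseteq> {0<..<length c}"
  shows "clopen_in Y (refined_base p C \<kappa>)"
proof -
  let ?R = "return_word p C ` C"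
  have "refined_base p C \<kappa> =
      (\<Union>c\<in>?R. \<Union>m\<in>insert 0 (\<kappa> c). (S ^^ m) ` {y\<in>C. return_word p C y = c})"
  proof (intro equalityI subsetI)
    fix v assume "v \<in> refined_base p C \<kappa>"
    then obtain m y where "v = (S ^^ m) y" "y \<in> C" "m \<in> insert 0 (\<kappa> (return_word p C y))"
      unfolding refined_base_def by blast
    then show "v \<in> (\<Union>c\<in>?R. \<Union>m\<in>insert 0 (\<kappa> c). (S ^^ m) ` {y\<in>C. return_word p C y = c})"
      by (intro UN_I[of "return_word p C y"] UN_I[of m]) auto
  next
    fix v assume "v \<in> (\<Union>c\<in>?R. \<Union>m\<in>insert 0 (\<kappa> c). (S ^^ m) ` {y\<in>C. return_word p C y = c})"
    then obtain c m y where "m \<in> insert 0 (\<kappa> c)" "v = (S ^^ m) y" "y \<in> C" "return_word p C y = c"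
      by blast
    then show "v \<in> refined_base p C \<kappa>"
      unfolding refined_base_def by blast
  qed
  moreover have "finite (insert 0 (\<kappa> c))" for c
    using \<kappa>[of c] finite_subset by auto
  ultimately show ?thesis
    using finite_return_words[OF C p(1)]
    by (simp only:) (intro clopen_in_UN clopen_in_image clopen_in_return_word_fibre C p(2))
qed

text \<open>Positions in the towers over \<open>C\<close> are unique, so an added cut met strictly
  between two visits to \<open>C\<close> belongs to the return word being traversed.\<close>

lemma refined_base_visit:
  assumes "C \<subseteq> Y" and \<kappa>: "\<And>c. \<kappa> c \<subseteq> {0<..<length c}"
    and y: "y \<in> C" and j: "0 < j" "j < return_time C y"
    and v: "(S ^^ j) y \<in> refined_base p C \<kappa>"
  shows "j \<in> \<kappa> (return_word p C y)"
proof -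
  obtain k z where z: "(S ^^ j) y = (S ^^ k) z" "z \<in> C" "k \<in> insert 0 (\<kappa> (return_word p C z))"
    using v unfolding refined_base_def by blast
  have "k \<noteq> 0"
  proof
    assume "k = 0"
    then have "(S ^^ j) y \<in> C" using z by simp
    then show False using return_time_min[OF j] by blast
  qed
  then have k: "k \<in> \<kappa> (return_word p C z)" using z by simp
  then have "k < return_time C z" using \<kappa>[of "return_word p C z"] by auto
  then have "y = z \<and> j = k"
    using return_towers_unique[OF assms(1) y z(2) j(2) _ z(1)] by blast
  then show ?thesis using k by simp
qed

text \<open>Strictly inside a return word \<open>c\<close> of \<open>C\<close> the new base is
  visited exactly at the times in \<open>\<kappa> c\<close>, so its return words are the segments
  between consecutive cuts. They depend on \<open>c\<close> alone and can be read off along any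
  other point with the same return word.\<close>

lemma refined_return_word:
  assumes C: "clopen_in Y C" "C \<noteq> {}" and \<kappa>: "\<And>c. \<kappa> c \<subseteq> {0<..<length c}"
    and v: "v \<in> refined_base p C \<kappa>"
  obtains c m m' where "c \<in> return_word p C ` C" "m \<in> insert 0 (\<kappa> c)" "m' \<in> insert (length c) (\<kappa> c)"
    "m < m'" "\<And>i. m < i \<Longrightarrow> i < m' \<Longrightarrow> i \<notin> \<kappa> c"
    "return_word p (refined_base p C \<kappa>) v = take (m' - m) (drop m c)"
proof -
  have CY: "C \<subseteq> Y" using C clopen_in_subset by auto
  obtain m y where y: "v = (S ^^ m) y" "y \<in> C" "m \<in> insert 0 (\<kappa> (return_word p C y))"
    using v unfolding refined_base_def by blast
  let ?c = "return_word p C y" and ?V = "refined_base p C \<kappa>"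
  have yY: "y \<in> Y" using y CY by auto
  note H = return_time_visit[OF C yY]
  have m: "m < length ?c"
    using y(3) \<kappa>[of ?c] H by auto
  define m' where "m' = (LEAST i. m < i \<and> i \<in> insert (length ?c) (\<kappa> ?c))"
  have m': "m < m'" "m' \<in> insert (length ?c) (\<kappa> ?c)"
    using LeastI[of "\<lambda>i. m < i \<and> i \<in> insert (length ?c) (\<kappa> ?c)" "length ?c"] m
    unfolding m'_def[symmetric] by auto
  have between: "i \<notin> insert (length ?c) (\<kappa> ?c)" if "m < i" "i < m'" for i
    using not_less_Least[of i "\<lambda>i. m < i \<and> i \<in> insert (length ?c) (\<kappa> ?c)"] that
    unfolding m'_def by auto
  have le: "m' \<le> return_time C y"
    using m'(2) \<kappa>[of ?c] by auto
  have shift: "(S ^^ j) v = (S ^^ (m + j)) y" for j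
    unfolding y(1) by (simp flip: funpow_add[unfolded comp_def, THEN fun_cong] add: add.commute)
  have rt: "return_time ?V v = m' - m"
  proof (rule return_time_eqI)
    show "0 < m' - m" using m' by simp
    have eq: "(S ^^ (m' - m)) v = (S ^^ m') y"
      using shift[of "m' - m"] m'(1) by simp
    show "(S ^^ (m' - m)) v \<in> ?V"
    proof (cases "m' = length ?c")
      case True
      then have "(S ^^ m') y \<in> C" using H by simp
      then have "(S ^^ 0) ((S ^^ m') y) \<in> ?V" unfolding refined_base_def by blast
      then show ?thesis unfolding eq by simp
    next
      case False
      then show ?thesis unfolding eq refined_base_def using m'(2) y(2) by blast
    qed
    fix j assume j: "0 < j" "j < m' - m"
    then have "m + j \<notin> \<kappa> ?c" using between[of "m + j"] by simp
    moreover have "m + j < return_time C y" using j le by linarith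
    ultimately show "(S ^^ j) v \<notin> ?V"
      using refined_base_visit[OF CY \<kappa> y(2), of "m + j" p] j(1) unfolding shift by auto
  qed
  have "return_word p ?V v = take (m' - m) (drop m ?c)"
  proof (rule nth_equalityI)
    show "length (return_word p ?V v) = length (take (m' - m) (drop m ?c))"
      using le by (simp add: rt)
    fix j assume "j < length (return_word p ?V v)"
    then have j: "j < m' - m" by (simp add: rt)
    then show "return_word p ?V v ! j = take (m' - m) (drop m ?c) ! j"
      using le by (simp add: nth_return_word rt shift)
  qed
  then show thesis
    using that[of ?c m m'] y m' between by blast
qed

text \<open>By \<open>const\<close> each tower of \<open>K\<close> has one word, independent of the
  base point. By \<open>base\<close> the letter \<open>M\<close> occurs over the bases; this gives
  \<open>p y = M\<close> for the maximal point \<open>y\<close> and keeps all added cuts in the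
  fibre of \<open>M\<close>.\<close>

lemma bounded_return_words:
  fixes X :: "'a::metric_space set" and T :: "'a \<Rightarrow> 'a" and \<alpha> :: "'a \<Rightarrow> 'b" and p :: "'b \<Rightarrow> nat"
  assumes X: "topological_dynamical_system X T" and K: "KR_partition X T K"
    and \<alpha>: "\<alpha> ` X = Y" "\<And>x. x \<in> X \<Longrightarrow> \<alpha> (T x) = S (\<alpha> x)"
    and p: "finite (p ` Y)" "\<And>a. clopen_in Y {y\<in>Y. p y = a}"
    and M: "\<And>y. y \<in> Y \<Longrightarrow> p y \<le> M"
    and const: "\<And>D x x'. D \<in> KR_cells T K \<Longrightarrow> x \<in> D \<Longrightarrow> x' \<in> D \<Longrightarrow> p (\<alpha> x) = p (\<alpha> x')"
    and base: "\<And>x. x \<in> KR_base K \<Longrightarrow> p (\<alpha> x) = M"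
  obtains V where "clopen_in Y V" "V \<noteq> {}" "\<And>v. v \<in> V \<Longrightarrow> p v = M"
    "card (return_word p V ` V) \<le> 3 * card K"
proof -
  interpret X: dynamical_system X T by unfold_locales (rule X)
  have finK: "finite K" using K by (simp add: KR_partition_def)
  obtain x0 where x0: "x0 \<in> X" using X.nonempty by auto
  obtain B0 h0 where B0: "(B0, h0) \<in> K"
    using X.KR_partition_cover[OF K x0] by metis
  have card1: "1 \<le> card K"
    using B0 finK card_0_eq[of K] by (cases "card K") auto
  have \<alpha>T: "\<alpha> ((T ^^ j) x) = (S ^^ j) (\<alpha> x)" if "x \<in> X" for x j
    using that by (induction j) (auto simp: \<alpha>(2) X.funpow_in)
  have \<alpha>Y: "\<alpha> x \<in> Y" if "x \<in> X" for x using that \<alpha>(1) by blast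
  have baseX: "KR_base K \<subseteq> X"
    using X.KR_partition_base_subset(1)[OF K] by (fastforce simp: KR_base_def)
  obtain y where y: "lex_maximal p y" using lex_maximal_exists[OF p] by blast
  then have yY: "y \<in> Y" by (simp add: lex_maximal_def)
  have py: "p y = M"
  proof -
    obtain b where "b \<in> B0" using X.KR_partition_base_subset(2)[OF K B0] by blast
    then have b: "b \<in> KR_base K" using B0 by (auto simp: KR_base_def)
    then have "\<alpha> b \<in> Y" using baseX \<alpha>Y by blast
    then have "\<forall>k. (\<forall>j<k. p ((S ^^ j) (\<alpha> b)) = p ((S ^^ j) y)) \<longrightarrow> p ((S ^^ k) (\<alpha> b)) \<le> p ((S ^^ k) y)"
      using y unfolding lex_maximal_def by blast
    from this[rule_format, of 0] have "p (\<alpha> b) \<le> p y" by simp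
    then show ?thesis using base[OF b] M[OF yY] by simp
  qed
  \<comment> \<open>Two levels of one tower differ by less than \<open>L\<close>, so a window of
    \<open>L\<close> letters on either side of time 0 is wide enough to detect a forbidden
    repetition.\<close>
  define L where "L = Max (snd ` K)"
  have L: "h \<le> L" if "(B, h) \<in> K" for B h
    unfolding L_def using finK that by (intro Max_ge) force+
  show thesis
  proof (cases "\<exists>g\<in>Y. \<exists>d>0. (S ^^ d) g = y \<and> (\<forall>k<d. p ((S ^^ k) g) = p ((S ^^ k) y))")
    case True
    then obtain g d where g: "g \<in> Y" "(S ^^ d) g = y" "0 < d" "\<And>k. k < d \<Longrightarrow> p ((S ^^ k) g) = p ((S ^^ k) y)"
      by blast
    have "p ((S ^^ (k + d)) y) = p ((S ^^ k) y)" for k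
      by (rule lex_maximal_square_imp_periodic[OF y g])
    then obtain V where "clopen_in Y V" "V \<noteq> {}" "\<And>v. v \<in> V \<Longrightarrow> p v = p y" "card (return_word p V ` V) = 1"
      using periodic_return_word[OF p yY g(3)] by blast
    then show thesis using card1 py by (intro that[of V]) auto
  next
    case False
    \<comment> \<open>Starting \<open>L\<close> steps before \<open>y\<close> turns the two-sided
      window around \<open>y\<close> into the times up to \<open>2 * L\<close> of \<open>g\<close>;
      time \<open>L\<close> of \<open>g\<close> is time 0 of \<open>y\<close>.\<close>
    obtain g where g: "g \<in> Y" "(S ^^ L) g = y" by (rule preimage[OF yY])
    have square_free: "\<exists>k<d. p ((S ^^ (L - d + k)) g) \<noteq> p ((S ^^ (L + k)) g)" if d: "0 < d" "d \<le> L" for d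
    proof -
      have "(S ^^ d) ((S ^^ (L - d)) g) = y"
        using g(2) d(2) by (simp flip: funpow_add[unfolded comp_def, THEN fun_cong])
      then obtain k where k: "k < d" "p ((S ^^ k) ((S ^^ (L - d)) g)) \<noteq> p ((S ^^ k) y)"
        using False d(1) funpow_in[OF g(1), of "L - d"] by blast
      have "(S ^^ k) ((S ^^ (L - d)) g) = (S ^^ (L - d + k)) g" "(S ^^ k) y = (S ^^ (L + k)) g"
        unfolding g(2)[symmetric]
        by (simp_all flip: funpow_add[unfolded comp_def, THEN fun_cong] add: add.commute)
      then show ?thesis using k by metis
    qed
    define G where "G = {z\<in>Y. \<forall>j\<in>{..2 * L}. p ((S ^^ j) z) = p ((S ^^ j) g)}"
    define C where "C = (S ^^ L) ` G"
    have G: "clopen_in Y G"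
      unfolding G_def using clopen_in_vimage[OF p(2)] by (intro clopen_in_Collect_ball) auto
    have gG: "g \<in> G" using g by (simp add: G_def)
    have C: "clopen_in Y C" "C \<noteq> {}"
      using clopen_in_image[OF G] gG by (auto simp: C_def)
    have CY: "C \<subseteq> Y" using C clopen_in_subset by auto
    have pC: "p z = M" if zC: "z \<in> C" for z
    proof -
      obtain z' where z': "z' \<in> G" "z = (S ^^ L) z'" using zC by (auto simp: C_def)
      have "p ((S ^^ L) z') = p ((S ^^ L) g)" using z'(1) by (simp add: G_def)
      then show ?thesis using z' g py by simp
    qed
    \<comment> \<open>Two offsets of one tower over \<open>C\<close> would make the itinerary of \<open>y\<close> repeat across time \<open>0\<close>
      with period their difference.\<close>
    have no_two: False
      if t: "(B, h) \<in> K" "b \<in> B" "b' \<in> B" "i < i'" "i' < h"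
        and iC: "\<alpha> ((T ^^ i) b) \<in> C" "\<alpha> ((T ^^ i') b') \<in> C" for B h b b' i i'
    proof -
      have bX: "b \<in> X" "b' \<in> X" using X.KR_partition_base_subset(1)[OF K t(1)] t(2,3) by auto
      let ?d = "i' - i"
      have d: "0 < ?d" "?d \<le> L" using t L[OF t(1)] by auto
      obtain z where z: "z \<in> G" "(S ^^ i) (\<alpha> b) = (S ^^ L) z"
        using iC(1) \<alpha>T[OF bX(1)] by (auto simp: C_def)
      obtain z' where z': "z' \<in> G" "(S ^^ i') (\<alpha> b') = (S ^^ L) z'"
        using iC(2) \<alpha>T[OF bX(2)] by (auto simp: C_def)
      have zY: "z' \<in> Y" using z' by (simp add: G_def)
      have "(S ^^ ?d) ((S ^^ i) (\<alpha> b')) = (S ^^ ?d) ((S ^^ (L - ?d)) z')"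
        using z'(2) d t(4) by (simp flip: funpow_add[unfolded comp_def, THEN fun_cong])
      then have e: "(S ^^ i) (\<alpha> b') = (S ^^ (L - ?d)) z'"
        using funpow_inj_on[of ?d] funpow_in \<alpha>Y[OF bX(2)] zY by (meson inj_onD)
      obtain k where k: "k < ?d" "p ((S ^^ (L - ?d + k)) g) \<noteq> p ((S ^^ (L + k)) g)"
        using square_free[OF d] by blast
      have cell: "(T ^^ (i + k)) ` B \<in> KR_cells T K"
        unfolding X.KR_cells_iff using t k by (intro exI[of _ B] exI[of _ h] exI[of _ "i + k"]) auto
      \<comment> \<open>Letters before time 0 are compared through \<open>z'\<close>, letters after
        it through \<open>z\<close>. Both read level \<open>i + k\<close> of the same tower, where
        \<open>const\<close> gives equal letters; \<open>k < ?d \<le> L\<close> keeps both indices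
        inside the window.\<close>
      have "p ((S ^^ (L - ?d + k)) g) = p ((S ^^ (L - ?d + k)) z')"
        using z'(1) k d by (simp add: G_def)
      also have "(S ^^ (L - ?d + k)) z' = (S ^^ (i + k)) (\<alpha> b')"
        using e by (simp add: add.commute[of _ k] funpow_add)
      also have "p \<dots> = p (\<alpha> ((T ^^ (i + k)) b'))" by (simp only: \<alpha>T[OF bX(2)])
      also have "\<dots> = p (\<alpha> ((T ^^ (i + k)) b))"
        using const[OF cell] t(2,3) by blast
      also have "\<dots> = p ((S ^^ (i + k)) (\<alpha> b))" by (simp only: \<alpha>T[OF bX(1)])
      also have "(S ^^ (i + k)) (\<alpha> b) = (S ^^ (L + k)) z"
        using z(2) by (simp add: add.commute[of _ k] funpow_add)
      also have "p \<dots> = p ((S ^^ (L + k)) g)"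
        using z(1) k d by (simp add: G_def)
      finally show False using k by simp
    qed
    \<comment> \<open>The value is arbitrary if the tower has no point over \<open>C\<close>; it is
      only evaluated when some point exists, and then \<open>no_two\<close> makes the level
      unique.\<close>
    define off where "off t = (SOME i. i < snd t \<and> (\<exists>b\<in>fst t. \<alpha> ((T ^^ i) b) \<in> C))" for t
    have off: "i = off (B, h)" if "(B, h) \<in> K" "b \<in> B" "i < h" "\<alpha> ((T ^^ i) b) \<in> C" for B h b i
    proof -
      have "\<exists>i. i < snd (B, h) \<and> (\<exists>b\<in>fst (B, h). \<alpha> ((T ^^ i) b) \<in> C)"
        using that by auto
      from someI_ex[OF this] have "off (B, h) < h" and "\<exists>b\<in>B. \<alpha> ((T ^^ off (B, h)) b) \<in> C"
        unfolding off_def by auto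
      then obtain b' where b': "b' \<in> B" "\<alpha> ((T ^^ off (B, h)) b') \<in> C" by blast
      show ?thesis
        using no_two[OF that(1,2) b'(1) _ \<open>off (B, h) < h\<close> that(4) b'(2)]
          no_two[OF that(1) b'(1) that(2) _ that(3) b'(2) that(4)] by (meson linorder_neqE_nat)
    qed
    define f where "f t = map (\<lambda>j. p (\<alpha> ((T ^^ j) (SOME b. b \<in> fst t)))) [0..<snd t]" for t
    have lenf: "length (f (B, h)) = h" for B h by (simp add: f_def)
    have f: "f (B, h) ! j = p (\<alpha> ((T ^^ j) b))" if "(B, h) \<in> K" "b \<in> B" "j < h" for B h b j
    proof -
      have "(SOME b. b \<in> B) \<in> B" using that(2) by (rule someI)
      moreover have "(T ^^ j) ` B \<in> KR_cells T K"
        unfolding X.KR_cells_iff using that by (intro exI[of _ B] exI[of _ h] exI[of _ j]) auto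
      ultimately show ?thesis
        using const that by (simp add: f_def)
    qed
    \<comment> \<open>The choice depends on the return word only and not on the point of
      \<open>C\<close>; so the cut times are constant on each fibre of the return word and
      \<open>V\<close> is clopen.\<close>
    define \<xi> where "\<xi> c = (SOME x. x \<in> X \<and> \<alpha> x \<in> C \<and> return_word p C (\<alpha> x) = c)" for c
    have \<xi>: "\<xi> c \<in> X" "\<alpha> (\<xi> c) \<in> C" "return_word p C (\<alpha> (\<xi> c)) = c" if c: "c \<in> return_word p C ` C" for c
    proof -
      obtain z where "z \<in> C" "return_word p C z = c" using c by auto
      moreover from this obtain x where "x \<in> X" "\<alpha> x = z" using CY \<alpha>(1) by blast
      ultimately have "\<exists>x. x \<in> X \<and> \<alpha> x \<in> C \<and> return_word p C (\<alpha> x) = c" by blast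
      from someI_ex[OF this] show "\<xi> c \<in> X" "\<alpha> (\<xi> c) \<in> C" "return_word p C (\<alpha> (\<xi> c)) = c"
        unfolding \<xi>_def by auto
    qed
    define \<kappa> where "\<kappa> c = {m\<in>{0<..<length c}. (T ^^ m) (\<xi> c) \<in> KR_base K}" for c
    have \<kappa>: "\<kappa> c \<subseteq> {0<..<length c}" for c by (auto simp: \<kappa>_def)
    define V where "V = refined_base p C \<kappa>"
    have V: "clopen_in Y V"
      unfolding V_def by (rule clopen_in_refined_base[OF C p \<kappa>])
    have CV: "C \<subseteq> V"
      unfolding V_def refined_base_def by (auto intro: exI[of _ 0])
    have pV: "p v = M" if vV: "v \<in> V" for v
    proof -
      obtain m z where z: "v = (S ^^ m) z" "z \<in> C" "m \<in> insert 0 (\<kappa> (return_word p C z))"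
        using vV unfolding V_def refined_base_def by blast
      show ?thesis
      proof (cases "m = 0")
        case True
        then show ?thesis using z pC by simp
      next
        case False
        let ?c = "return_word p C z"
        have c: "?c \<in> return_word p C ` C" using z by blast
        have m: "m < length ?c" "(T ^^ m) (\<xi> ?c) \<in> KR_base K"
          using z False by (auto simp: \<kappa>_def)
        have "length (return_word p C (\<alpha> (\<xi> ?c))) = length ?c" by (simp only: \<xi>(3)[OF c])
        then have m2: "m < return_time C (\<alpha> (\<xi> ?c))" using m(1) by simp
        \<comment> \<open>The cut at time \<open>m\<close> was read off from \<open>\<xi> ?c\<close>
          and not from a point over \<open>z\<close>, but the letter there is fixed by the common
          word \<open>?c\<close>.\<close>
        have "p v = ?c ! m" using z(1) m(1) by (simp add: nth_return_word)
        also have "\<dots> = p ((S ^^ m) (\<alpha> (\<xi> ?c)))"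
          using nth_return_word[OF m2, of p] unfolding \<xi>(3)[OF c] .
        also have "\<dots> = M"
          using base[OF m(2)] \<alpha>T[OF \<xi>(1)[OF c]] by simp
        finally show ?thesis .
      qed
    qed
    have words: "return_word p V ` V \<subseteq> (\<Union>t\<in>K. {f t, drop (off t) (f t), take (off t) (f t)})"
    proof
      fix w assume "w \<in> return_word p V ` V"
      then obtain v where v: "v \<in> V" "w = return_word p V v" by blast
      obtain c m m' where c: "c \<in> return_word p C ` C" "m \<in> insert 0 (\<kappa> c)" "m' \<in> insert (length c) (\<kappa> c)"
        "m < m'" and between: "\<And>i. m < i \<Longrightarrow> i < m' \<Longrightarrow> i \<notin> \<kappa> c"
        and w: "w = take (m' - m) (drop m c)"
        using refined_return_word[OF C \<kappa> v(1)[unfolded V_def]] unfolding v(2) V_def by metis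
      let ?x = "\<xi> c" and ?H = "length c"
      note x = \<xi>[OF c(1)]
      have H: "?H = return_time C (\<alpha> ?x)" using x(3) length_return_word by metis
      have HC: "\<alpha> ((T ^^ ?H) ?x) \<in> C"
        unfolding \<alpha>T[OF x(1)] H using x(2) CY by (intro return_time_visit(2)[OF C]) blast
      have cj: "c ! j = p (\<alpha> ((T ^^ j) ?x))" if "j < ?H" for j
        using nth_return_word[of j C "\<alpha> ?x" p] that x(3) \<alpha>T[OF x(1), of j] H by simp
      have m'H: "m' \<le> ?H" using c(3) \<kappa>[of c] by auto
      have "(T ^^ m) ?x \<in> X" by (rule X.funpow_in[OF x(1)])
      then obtain B h b i where b: "(B, h) \<in> K" "b \<in> B" "i < h" "(T ^^ m) ?x = (T ^^ i) b"
        using X.KR_partition_cover[OF K] by metis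
      have shift: "(T ^^ (m + j)) ?x = (T ^^ (i + j)) b" for j
        using b(4) by (simp add: add.commute[of _ j] funpow_add)
      \<comment> \<open>A segment begins at a cut, which is the bottom of a tower, or at the visit
        to \<open>C\<close>, where the level is the offset of the tower.\<close>
      have i: "i = 0 \<or> m = 0 \<and> i = off (B, h)"
      proof (cases "m = 0")
        case True
        then have "\<alpha> ((T ^^ i) b) \<in> C" using x(2) b(4) by simp
        then show ?thesis using off[OF b(1-3)] True by blast
      next
        case False
        then have "(T ^^ i) b \<in> KR_base K" using c(2) b(4) by (auto simp: \<kappa>_def)
        then have "\<not> 0 < i" using X.KR_partition_not_base[OF K b(1,2) _ b(3)] by blast
        then show ?thesis by simp
      qed
      \<comment> \<open>A segment cannot run past the top of its tower: there the orbit meets the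
        base, which would be an earlier cut.\<close>
      have le: "m' - m \<le> h - i"
      proof (rule ccontr)
        assume gt: "\<not> m' - m \<le> h - i"
        have "(T ^^ (m + (h - i))) ?x \<in> KR_base K"
          using shift[of "h - i"] X.KR_partition_top[OF K b(1,2)] b(3) by simp
        then have "m + (h - i) \<in> \<kappa> c"
          using gt m'H b(3) by (auto simp: \<kappa>_def)
        moreover have "m < m + (h - i)" "m + (h - i) < m'" using gt b(3) by arith+
        ultimately show False using between by blast
      qed
      have wf: "w = take (m' - m) (drop i (f (B, h)))"
      proof (rule nth_equalityI)
        show "length w = length (take (m' - m) (drop i (f (B, h))))"
          using le m'H by (simp add: w lenf)
        fix j assume "j < length w"
        then have j: "j < m' - m" by (simp add: w)
        then have "w ! j = c ! (m + j)" using m'H by (simp add: w)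
        also have "\<dots> = p (\<alpha> ((T ^^ (i + j)) b))"
          using cj[of "m + j"] shift[of j] j m'H by simp
        also have "\<dots> = f (B, h) ! (i + j)"
          using f[OF b(1,2), of "i + j"] j le b(3) by simp
        finally show "w ! j = take (m' - m) (drop i (f (B, h))) ! j"
          using j le by (simp add: lenf)
      qed
      show "w \<in> (\<Union>t\<in>K. {f t, drop (off t) (f t), take (off t) (f t)})"
      \<comment> \<open>A segment reaching the top is the whole word (\<open>i = 0\<close>) or the
        suffix from the offset. One that stops earlier is stopped by the return to \<open>C\<close>,
        hence at level \<open>off (B, h)\<close>; it cannot also start there, so it is the
        prefix.\<close>
      proof (cases "m' - m = h - i")
        case True
        then have "w = drop i (f (B, h))" using wf by (simp add: lenf)
        then have "w \<in> {f (B, h), drop (off (B, h)) (f (B, h)), take (off (B, h)) (f (B, h))}"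
          using i by auto
        then show ?thesis using b(1) by blast
      next
        case False
        then have lt: "0 < i + (m' - m)" "i + (m' - m) < h" using le c(4) by arith+
        have eq: "(T ^^ m') ?x = (T ^^ (i + (m' - m))) b"
          using shift[of "m' - m"] c(4) by simp
        have "m' = ?H"
        proof (rule ccontr)
          assume "m' \<noteq> ?H"
          then have "(T ^^ (i + (m' - m))) b \<in> KR_base K"
            using c(3) eq by (auto simp: \<kappa>_def)
          then show False
            using X.KR_partition_not_base[OF K b(1,2) lt] by blast
        qed
        then have "\<alpha> ((T ^^ (i + (m' - m))) b) \<in> C" using HC eq by simp
        then have o: "i + (m' - m) = off (B, h)"
          by (rule off[OF b(1,2) lt(2)])
        then have "i = 0" using i c(4) by auto
        then have "w = take (off (B, h)) (f (B, h))" using wf o by simp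
        then show ?thesis using b(1) by blast
      qed
    qed
    have "card (return_word p V ` V) \<le> card (\<Union>t\<in>K. {f t, drop (off t) (f t), take (off t) (f t)})"
      using finK by (intro card_mono words) auto
    also have "\<dots> \<le> (\<Sum>t\<in>K. card {f t, drop (off t) (f t), take (off t) (f t)})"
      by (rule card_UN_le[OF finK])
    also have "\<dots> \<le> (\<Sum>t\<in>K. 3)"
      by (intro sum_mono) (simp add: card_insert_if)
    finally have "card (return_word p V ` V) \<le> 3 * card K" by simp
    moreover have "V \<noteq> {}" using C CV by blast
    ultimately show thesis using that V pV by blast
  qed
qed

end

section \<open>Realizations\<close>

context dynamical_system
begin

lemma clopen_in_KR_base:
  assumes "KR_partition Y S K"
  shows "clopen_in Y (KR_base K)"
proof -
  have "KR_base K = (\<Union>t\<in>K. fst t)" by (auto simp: KR_base_def)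
  moreover have "clopen_in Y (fst t)" if "t \<in> K" for t
    using KR_partition_base_subset(4)[OF assms, of "fst t" "snd t"] that assms
    by (simp add: KR_partition_def clopen_in_def)
  moreover have "finite K" using assms by (simp add: KR_partition_def)
  ultimately show ?thesis using clopen_in_UN by metis
qed

lemma KR_cells_partition:
  assumes "KR_partition Y S K"
  shows Union_KR_cells: "\<Union>(KR_cells S K) = Y"
    and KR_cells_eqI: "\<And>C D y. C \<in> KR_cells S K \<Longrightarrow> D \<in> KR_cells S K \<Longrightarrow> y \<in> C \<Longrightarrow> y \<in> D \<Longrightarrow> C = D"
    and KR_cell_nonempty: "\<And>C. C \<in> KR_cells S K \<Longrightarrow> C \<noteq> {}"
    and clopen_in_KR_cell: "\<And>C. C \<in> KR_cells S K \<Longrightarrow> clopen_in Y C"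
proof -
  have p: "partition_on Y (KR_cells S K)" and
    c: "\<forall>C\<in>KR_cells S K. openin (top_of_set Y) C \<and> closedin (top_of_set Y) C"
    using assms by (simp_all add: KR_partition_def)
  show "\<Union>(KR_cells S K) = Y" using p by (simp add: partition_on_def)
  show "C = D" if "C \<in> KR_cells S K" "D \<in> KR_cells S K" "y \<in> C" "y \<in> D" for C D y
    using p that disjointD[of "KR_cells S K" C D] unfolding partition_on_def by blast
  show "C \<noteq> {}" if "C \<in> KR_cells S K" for C
    using p that by (auto simp: partition_on_def)
  show "clopen_in Y C" if "C \<in> KR_cells S K" for C
    using c that by (simp add: clopen_in_def)
qed

lemma KR_realizationD:
  assumes "KR_realization Y S K"
  shows "KR_partition Y S (K n)"
    and "C \<in> KR_cells S (K (Suc n)) \<Longrightarrow> \<exists>D\<in>KR_cells S (K n). C \<subseteq> D"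
    and "KR_base (K (Suc n)) \<subseteq> KR_base (K n)"
    and "topology_generated_by (\<Union>n. KR_cells S (K n)) = top_of_set Y"
  using assms by (simp_all add: KR_realization_def)

lemma KR_partition_trivial: "KR_partition Y S {(Y, 1)}"
proof -
  have "tower_index {(Y, 1)} = {((Y, 1), 0)}" by (auto simp: tower_index_def)
  moreover from this have "KR_cells S {(Y, 1)} = {Y}" by (simp add: KR_cells_def tower_level_def)
  ultimately show ?thesis
    using nonempty by (auto simp: KR_partition_def partition_on_def)
qed

lemma KR_realization_refines:
  assumes K: "KR_realization Y S K" and "m \<le> n" "C \<in> KR_cells S (K n)" "D \<in> KR_cells S (K m)"
    and "y \<in> C" "y \<in> D"
  shows "C \<subseteq> D"
proof -
  have "\<exists>D'\<in>KR_cells S (K m). C \<subseteq> D'"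
    using assms(2,3)
  proof (induction n arbitrary: C rule: dec_induct)
    case (step n)
    obtain C' where C': "C' \<in> KR_cells S (K n)" "C \<subseteq> C'"
      using KR_realizationD(2)[OF K step.prems] by blast
    then obtain D' where "D' \<in> KR_cells S (K m)" "C' \<subseteq> D'"
      using step.IH[OF C'(1)] by blast
    then show ?case using C'(2) by blast
  qed blast
  then obtain D' where D': "D' \<in> KR_cells S (K m)" "C \<subseteq> D'" by blast
  have "y \<in> D'" using D'(2) assms(5) by blast
  then have "D = D'"
    by (rule KR_cells_eqI[OF KR_realizationD(1)[OF K] assms(4) D'(1) assms(6)])
  then show ?thesis using D' by simp
qed

lemma KR_realization_cell:
  assumes "KR_realization Y S K" "y \<in> Y"
  obtains C where "C \<in> KR_cells S (K n)" "y \<in> C"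
  using Union_KR_cells[OF KR_realizationD(1)[OF assms(1), of n]] assms(2) that by blast

text \<open>The cells are only assumed to be a subbasis. Refinement makes them a basis: two cells
  containing a point both contain its cell at the later of their levels.\<close>

lemma KR_realization_basis:
  assumes K: "KR_realization Y S K" and "openin (top_of_set Y) G" "y \<in> G"
  obtains n C where "C \<in> KR_cells S (K n)" "y \<in> C" "C \<subseteq> G"
proof -
  have "generate_topology_on (\<Union>n. KR_cells S (K n)) G"
    using assms(2) openin_topology_generated_by_iff KR_realizationD(4)[OF K] by metis
  then have "\<forall>y\<in>G. \<exists>n. \<exists>C\<in>KR_cells S (K n). y \<in> C \<and> C \<subseteq> G"
  proof induction
    case (Int a b)
    show ?case
    proof
      fix y assume y: "y \<in> a \<inter> b"
      have "y \<in> a" "y \<in> b" using y by auto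
      obtain m C where C: "C \<in> KR_cells S (K m)" "y \<in> C" "C \<subseteq> a"
        using bspec[OF Int.IH(1) \<open>y \<in> a\<close>] by blast
      obtain n D where D: "D \<in> KR_cells S (K n)" "y \<in> D" "D \<subseteq> b"
        using bspec[OF Int.IH(2) \<open>y \<in> b\<close>] by blast
      have "y \<in> Y" using C(1,2) Union_KR_cells[OF KR_realizationD(1)[OF K]] by blast
      then obtain E where E: "E \<in> KR_cells S (K (max m n))" "y \<in> E"
        by (rule KR_realization_cell[OF K])
      then have "E \<subseteq> C" "E \<subseteq> D"
        using KR_realization_refines[OF K _ E(1) C(1) E(2) C(2)]
          KR_realization_refines[OF K _ E(1) D(1) E(2) D(2)] by auto
      then show "\<exists>n. \<exists>C\<in>KR_cells S (K n). y \<in> C \<and> C \<subseteq> a \<inter> b" using E C D by blast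
    qed
  next
    case (UN \<K>)
    show ?case
    proof
      fix y assume "y \<in> \<Union>\<K>"
      then obtain k where k: "k \<in> \<K>" "y \<in> k" by blast
      then obtain n C where "C \<in> KR_cells S (K n)" "y \<in> C" "C \<subseteq> k"
        using bspec[OF UN.IH[OF k(1)] k(2)] by blast
      then show "\<exists>n. \<exists>C\<in>KR_cells S (K n). y \<in> C \<and> C \<subseteq> \<Union>\<K>" using k(1) by blast
    qed
  qed blast+
  then show thesis using that bspec[OF _ assms(3)] by blast
qed

text \<open>Two uses of compactness: finitely many cells on which \<open>q\<close> is constant cover
  the space, and bases shrinking to \<open>x\<close> eventually avoid the clopen set where
  \<open>q\<close> differs from \<open>q x\<close>. The later of the two levels serves both
  claims.\<close>

lemma KR_realization_locally_constant:
  assumes K: "KR_realization Y S K" and x: "(\<Inter>n. KR_base (K n)) = {x}"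
    and q: "\<And>a. clopen_in Y {y\<in>Y. q y = a}"
  obtains n where "\<And>C y z. C \<in> KR_cells S (K n) \<Longrightarrow> y \<in> C \<Longrightarrow> z \<in> C \<Longrightarrow> q y = q z"
    "\<And>y. y \<in> KR_base (K n) \<Longrightarrow> q y = q x"
proof -
  note KR = KR_realizationD(1)[OF K]
  define good where "good = {C. (\<exists>n. C \<in> KR_cells S (K n)) \<and> (\<forall>y\<in>C. \<forall>z\<in>C. q y = q z)}"
  have "\<forall>C\<in>good. openin (top_of_set Y) C"
    using clopen_in_KR_cell[OF KR] unfolding good_def clopen_in_def by blast
  moreover have "Y \<subseteq> \<Union>good"
  proof
    fix y assume y: "y \<in> Y"
    have "openin (top_of_set Y) {z\<in>Y. q z = q y}" using q by (simp add: clopen_in_def)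
    then obtain n C where C: "C \<in> KR_cells S (K n)" "y \<in> C" "C \<subseteq> {z\<in>Y. q z = q y}"
      by (rule KR_realization_basis[OF K]) (use y in auto)
    have qC: "q z = q y" if "z \<in> C" for z using C(3) that by auto
    have "C \<in> good" unfolding good_def using C(1) by (auto simp: qC)
    then show "y \<in> \<Union>good" using C by auto
  qed
  ultimately obtain F where F: "F \<subseteq> good" "finite F" "Y \<subseteq> \<Union>F"
    using compact_space[unfolded compact_eq_openin_cover, THEN spec, of good] by blast
  then have "\<forall>C\<in>F. \<exists>n. C \<in> KR_cells S (K n)" by (auto simp: good_def)
  then obtain level where level: "\<And>C. C \<in> F \<Longrightarrow> C \<in> KR_cells S (K (level C))" by metis
  define N where "N = Max (insert 0 (level ` F))"
  have N: "level C \<le> N" if "C \<in> F" for C using that F(2) by (simp add: N_def)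
  have "\<exists>n. KR_base (K n) \<inter> {y\<in>Y. q y \<noteq> q x} = {}"
  proof (rule ccontr)
    assume ne: "\<nexists>n. KR_base (K n) \<inter> {y\<in>Y. q y \<noteq> q x} = {}"
    have "(\<Inter>n. KR_base (K n) \<inter> {y\<in>Y. q y \<noteq> q x}) \<noteq> {}"
    proof (rule compact_decseq_Inter_nonempty[OF compact_space])
      show "closedin (top_of_set Y) (KR_base (K n) \<inter> {y\<in>Y. q y \<noteq> q x})" for n
        using clopen_in_Int[OF clopen_in_KR_base[OF KR] clopen_in_Collect_not[OF q]]
        by (simp add: clopen_in_def)
      show "KR_base (K n) \<inter> {y\<in>Y. q y \<noteq> q x} \<noteq> {}" for n using ne by blast
      show "decseq (\<lambda>n. KR_base (K n) \<inter> {y\<in>Y. q y \<noteq> q x})"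
        by (intro decseq_SucI Int_mono KR_realizationD(3)[OF K] order_refl)
    qed
    then show False using x by auto
  qed
  then obtain N' where N': "KR_base (K N') \<inter> {y\<in>Y. q y \<noteq> q x} = {}" by blast
  have dec: "decseq (\<lambda>n. KR_base (K n))"
    by (intro decseq_SucI KR_realizationD(3)[OF K])
  show thesis
  proof
    fix C y z assume C: "C \<in> KR_cells S (K (max N N'))" "y \<in> C" "z \<in> C"
    have "y \<in> Y" using C(1,2) Union_KR_cells[OF KR] by blast
    then obtain D where D: "D \<in> F" "y \<in> D" using F(3) by blast
    have "C \<subseteq> D"
      using KR_realization_refines[OF K _ C(1) level[OF D(1)] C(2) D(2)] N[OF D(1)] by simp
    moreover have "D \<in> good" using D(1) F(1) by blast
    ultimately show "q y = q z" using C(2,3) unfolding good_def by blast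
  next
    fix y assume y: "y \<in> KR_base (K (max N N'))"
    then have "y \<in> KR_base (K N')" using decseqD[OF dec, of N' "max N N'"] by auto
    moreover have "y \<in> Y" using y clopen_in_subset[OF clopen_in_KR_base[OF KR]] by blast
    ultimately show "q y = q x" using N' by blast
  qed
qed

end

section \<open>Transfer to the factor and construction of its realization\<close>

context minimal_dynamical_system
begin

text \<open>The image is closed and contains a whole two-sided orbit, which is dense; backward
  points are reached by lifting preimages under the iterates of \<open>T\<close>.\<close>

lemma factor_map_surj:
  fixes X :: "'a::metric_space set"
  assumes X: "topological_dynamical_system X T" and \<alpha>: "continuous_on X \<alpha>" "\<alpha> ` X \<subseteq> Y"
    "\<And>x. x \<in> X \<Longrightarrow> \<alpha> (T x) = S (\<alpha> x)"
  shows "\<alpha> ` X = Y"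
proof -
  interpret X: dynamical_system X T by unfold_locales (rule X)
  have \<alpha>T: "\<alpha> ((T ^^ j) x) = (S ^^ j) (\<alpha> x)" if "x \<in> X" for x j
    using that by (induction j) (auto simp: \<alpha>(3) X.funpow_in)
  obtain x where x: "x \<in> X" using X.nonempty by blast
  then have y: "\<alpha> x \<in> Y" using \<alpha>(2) by blast
  have "orbit_on Y S (\<alpha> x) \<subseteq> \<alpha> ` X"
  proof
    fix z assume "z \<in> orbit_on Y S (\<alpha> x)"
    then obtain n where "z = (S ^^ n) (\<alpha> x) \<or> z = (inv_into Y S ^^ n) (\<alpha> x)"
      by (auto simp: orbit_on_def)
    then show "z \<in> \<alpha> ` X"
    proof
      assume "z = (S ^^ n) (\<alpha> x)"
      then show ?thesis using \<alpha>T[OF x, of n] X.funpow_in[OF x, of n] by (metis imageI)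
    next
      assume z: "z = (inv_into Y S ^^ n) (\<alpha> x)"
      obtain x' where x': "x' \<in> X" "(T ^^ n) x' = x" by (rule X.preimage[OF x])
      have "(S ^^ n) (\<alpha> x') = (S ^^ n) z"
        using \<alpha>T[OF x'(1), of n] x'(2) funpow_inv(2)[OF y, of n] z by simp
      moreover have "z \<in> Y" "\<alpha> x' \<in> Y" using funpow_inv(1)[OF y] z x'(1) \<alpha>(2) by auto
      ultimately have "\<alpha> x' = z" using funpow_inj_on[of n] by (meson inj_onD)
      then show ?thesis using x'(1) by blast
    qed
  qed
  moreover have "closed (\<alpha> ` X)"
    using compact_continuous_image[OF \<alpha>(1) X.compact_space] by (rule compact_imp_closed)
  ultimately have "closure (orbit_on Y S (\<alpha> x)) \<subseteq> \<alpha> ` X" by (rule closure_minimal)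
  moreover have "Y \<subseteq> closure (orbit_on Y S (\<alpha> x))"
    using minimal y by (simp add: minimal_system_def)
  ultimately show ?thesis using \<alpha>(2) by blast
qed

lemma bounded_return_words_factor:
  fixes X :: "'a::metric_space set" and p :: "'b \<Rightarrow> nat"
  assumes X: "topological_dynamical_system X T" and K: "KR_realization X T K" "\<And>n. card (K n) \<le> r"
    and \<alpha>: "continuous_on X \<alpha>" "\<alpha> ` X \<subseteq> Y" "\<And>x. x \<in> X \<Longrightarrow> \<alpha> (T x) = S (\<alpha> x)"
    and p: "finite (p ` Y)" "\<And>a. clopen_in Y {y\<in>Y. p y = a}"
    and M: "M \<in> p ` Y" "\<And>y. y \<in> Y \<Longrightarrow> p y \<le> M"
  shows "\<exists>V. clopen_in Y V \<and> V \<noteq> {} \<and> (\<forall>v\<in>V. p v = M) \<and> card (return_word p V ` V) \<le> 3 * r"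
proof -
  interpret X: dynamical_system X T by unfold_locales (rule X)
  note KR = X.KR_realizationD(1)[OF K(1)]
  obtain x where x: "(\<Inter>n. KR_base (K n)) = {x}" using K by (auto simp: KR_realization_def)
  then have "x \<in> KR_base (K 0)" by blast
  then have xX: "x \<in> X" using clopen_in_subset[OF X.clopen_in_KR_base[OF KR]] by blast
  have "{y\<in>Y. p y = M} \<noteq> {}" using M(1) by blast
  then obtain N where "\<And>y. y \<in> Y \<Longrightarrow> \<exists>k\<le>N. (S ^^ k) y \<in> {y\<in>Y. p y = M}"
    using bounded_visits[OF p(2)] by blast
  then obtain k where k: "p ((S ^^ k) (\<alpha> x)) = M" using xX \<alpha>(2) by blast
  \<comment> \<open>The bases shrink to \<open>x\<close>, but \<open>\<alpha> x\<close> need not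
    carry the letter \<open>M\<close>. Some iterate of it does, by minimality, and composing with
    that iterate gives another factor map.\<close>
  define \<beta> where "\<beta> = (S ^^ k) \<circ> \<alpha>"
  have surj: "\<beta> ` X = Y"
    using factor_map_surj[OF X \<alpha>] funpow_image[of k] unfolding \<beta>_def image_comp[symmetric] by simp
  have equi: "\<beta> (T x) = S (\<beta> x)" if "x \<in> X" for x
    using \<alpha>(3)[OF that] by (simp add: \<beta>_def funpow_swap1)
  have "continuous_on X \<beta>"
    unfolding \<beta>_def by (intro continuous_on_compose \<alpha>(1)) (rule continuous_on_subset[OF funpow_cont \<alpha>(2)])
  then have q: "clopen_in X {z\<in>X. (p \<circ> \<beta>) z = a}" for a
  proof -
    assume c: "continuous_on X \<beta>"
    have "{z\<in>X. (p \<circ> \<beta>) z = a} = X \<inter> \<beta> -` {y\<in>Y. p y = a}" using surj by auto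
    moreover have "\<beta> \<in> X \<rightarrow> Y" using surj by auto
    ultimately show ?thesis
      using p(2)[of a] continuous_openin_preimage[OF c] continuous_closedin_preimage_gen[OF c]
      unfolding clopen_in_def by (simp only:)
  qed
  obtain n where n: "\<And>C y z. C \<in> KR_cells T (K n) \<Longrightarrow> y \<in> C \<Longrightarrow> z \<in> C \<Longrightarrow> (p \<circ> \<beta>) y = (p \<circ> \<beta>) z"
    "\<And>y. y \<in> KR_base (K n) \<Longrightarrow> (p \<circ> \<beta>) y = (p \<circ> \<beta>) x"
    using X.KR_realization_locally_constant[OF K(1) x q] by blast
  have base: "p (\<beta> y) = M" if "y \<in> KR_base (K n)" for y
    using n(2)[OF that] k by (simp add: \<beta>_def)
  have const: "p (\<beta> y) = p (\<beta> z)" if "C \<in> KR_cells T (K n)" "y \<in> C" "z \<in> C" for C y z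
    using n(1)[OF that] by simp
  show ?thesis
  proof (rule bounded_return_words[OF X KR[of n] surj, of p M])
    fix V assume V: "clopen_in Y V" "V \<noteq> {}" "\<And>v. v \<in> V \<Longrightarrow> p v = M"
      "card (return_word p V ` V) \<le> 3 * card (K n)"
    have "card (return_word p V ` V) \<le> 3 * r" using V(4) K(2)[of n] by simp
    then show ?thesis using V(1-3) by blast
  qed (fact equi p M(2) const base)+
qed

text \<open>A labelling with fibres inside small subsets of the cells of \<open>K\<close> is fed
  into \<open>R\<close>. The largest label is reserved for a neighbourhood of a point
  \<open>b\<close> of the old base, so the condition \<open>p v = M\<close> forces the new base into
  the old one.\<close>

lemma KR_partition_refine:
  assumes td: "totally_disconnected Y"
    and R: "\<And>(p :: 'b \<Rightarrow> nat) M. finite (p ` Y) \<Longrightarrow> (\<And>a. clopen_in Y {y\<in>Y. p y = a}) \<Longrightarrow> M \<in> p ` Y \<Longrightarrow>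
      (\<And>y. y \<in> Y \<Longrightarrow> p y \<le> M) \<Longrightarrow>
      \<exists>V. clopen_in Y V \<and> V \<noteq> {} \<and> (\<forall>v\<in>V. p v = M) \<and> card (return_word p V ` V) \<le> R"
    and K: "KR_partition Y S K" and e: "0 < e"
  shows "\<exists>K'. KR_partition Y S K' \<and> card K' \<le> R \<and>
      KR_base K' \<subseteq> KR_base K \<and> (\<forall>C\<in>KR_cells S K'. \<exists>D\<in>KR_cells S K. C \<subseteq> D) \<and>
      (\<forall>C\<in>KR_cells S K'. \<forall>x\<in>C. \<forall>y\<in>C. dist x y < e) \<and>
      (\<forall>x\<in>KR_base K'. \<forall>y\<in>KR_base K'. dist x y < e)"
proof -
  have "\<exists>A. clopen_in Y A \<and> y \<in> A \<and> A \<subseteq> ball y (e / 2) \<and> (\<forall>D\<in>KR_cells S K. y \<in> D \<longrightarrow> A \<subseteq> D)" if y: "y \<in> Y" for y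
  proof -
    obtain D where D: "D \<in> KR_cells S K" "y \<in> D"
      using y Union_KR_cells[OF K] by blast
    then obtain G where G: "open G" "D = Y \<inter> G"
      using clopen_in_KR_cell[OF K D(1)] unfolding clopen_in_def openin_open by blast
    obtain A where A: "clopen_in Y A" "y \<in> A" "A \<subseteq> G \<inter> ball y (e / 2)"
      by (rule clopen_in_nbhd[OF compact_space td y, of "G \<inter> ball y (e / 2)"]) (use G D e in auto)
    have "D' = D" if "D' \<in> KR_cells S K" "y \<in> D'" for D'
      by (rule KR_cells_eqI[OF K that(1) D(1) that(2) D(2)])
    then show ?thesis
      using A G clopen_in_subset[OF A(1)] by (intro exI[of _ A]) auto
  qed
  then obtain A where A: "\<And>y. y \<in> Y \<Longrightarrow> clopen_in Y (A y)" "\<And>y. y \<in> Y \<Longrightarrow> y \<in> A y"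
    "\<And>y. y \<in> Y \<Longrightarrow> A y \<subseteq> ball y (e / 2)" "\<And>y D. y \<in> Y \<Longrightarrow> D \<in> KR_cells S K \<Longrightarrow> y \<in> D \<Longrightarrow> A y \<subseteq> D"
    by metis
  have small: "dist u v < e" if "y \<in> Y" "u \<in> A y" "v \<in> A y" for y u v
    using A(3)[OF that(1)] that(2,3) dist_triangle_half_r[of y u e v] by (auto simp: subset_iff)
  obtain x where "x \<in> Y" using nonempty by blast
  then obtain B h b i where b: "(B, h) \<in> K" "b \<in> B"
    using KR_partition_cover[OF K] by metis
  have bY: "b \<in> Y" using KR_partition_base_subset(1)[OF K b(1)] b(2) by blast
  have "\<forall>c\<in>A ` Y. openin (top_of_set Y) c" using A(1) by (auto simp: clopen_in_def)
  moreover have "Y \<subseteq> \<Union>(A ` Y)" using A(2) by blast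
  ultimately obtain \<F> where \<F>: "\<F> \<subseteq> A ` Y" "finite \<F>" "Y \<subseteq> \<Union>\<F>"
    using compact_space[unfolded compact_eq_openin_cover, THEN spec, of "A ` Y"] by blast
  obtain F where F: "F \<subseteq> Y" "finite F" "\<F> = A ` F" using finite_subset_image[OF \<F>(2,1)] by blast
  obtain zs where zs: "set zs = F" using finite_list[OF F(2)] by blast
  define n where "n = length zs"
  \<comment> \<open>Outside \<open>A b\<close> the label is the first index of a covering set, hence
    below \<open>n\<close>; so \<open>n\<close> is the maximum and its fibre is exactly
    \<open>A b\<close>.\<close>
  define p where "p y = (if y \<in> A b then n else LEAST i. y \<in> A (zs ! i))" for y
  have least: "(LEAST i. y \<in> A (zs ! i)) < n \<and> y \<in> A (zs ! (LEAST i. y \<in> A (zs ! i)))" if y: "y \<in> Y" for y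
  proof -
    obtain z where "z \<in> F" "y \<in> A z" using y \<F>(3) F(3) by blast
    then obtain i where i: "i < n" "y \<in> A (zs ! i)" using zs by (auto simp: in_set_conv_nth n_def)
    then show ?thesis
      using LeastI[of "\<lambda>i. y \<in> A (zs ! i)" i] Least_le[of "\<lambda>i. y \<in> A (zs ! i)" i] by simp
  qed
  have zsY: "zs ! i \<in> Y" if "i < n" for i using that zs F(1) by (auto simp: n_def)
  have p_le: "p y \<le> n" if "y \<in> Y" for y using least[OF that] by (simp add: p_def)
  \<comment> \<open>The centre attached to a label: the fibre of \<open>i\<close> lies in
    \<open>A (c i)\<close>.\<close>
  define c where "c i = (if i = n then b else zs ! i)" for i
  have cY: "c (p y) \<in> Y" and Ac: "y \<in> A (c (p y))" if "y \<in> Y" for y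
    using least[OF that] bY zsY by (auto simp: c_def p_def)
  have fib: "clopen_in Y {y\<in>Y. p y = a}" for a
  proof -
    consider "a = n" | "a < n" | "n < a" by linarith
    then show ?thesis
    proof cases
      case 1
      have "p y = n \<longleftrightarrow> y \<in> A b" if "y \<in> Y" for y
        using least[OF that] by (auto simp: p_def)
      then have "{y\<in>Y. p y = a} = A b"
        using clopen_in_subset[OF A(1)[OF bY]] 1 by blast
      then show ?thesis using A(1)[OF bY] by simp
    next
      case 2
      have "p y = a \<longleftrightarrow> \<not> y \<in> A b \<and> y \<in> A (zs ! a) \<and> (\<forall>j\<in>{..<a}. \<not> y \<in> A (zs ! j))" if y: "y \<in> Y" for y
      proof
        assume "p y = a"
        then have "y \<notin> A b" and a: "(LEAST i. y \<in> A (zs ! i)) = a"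
          using 2 by (auto simp: p_def split: if_splits)
        moreover have "y \<in> A (zs ! a)" using least[OF y] unfolding a by blast
        moreover have "y \<notin> A (zs ! j)" if "j < a" for j
          using not_less_Least[of j "\<lambda>i. y \<in> A (zs ! i)"] that unfolding a by blast
        ultimately show "\<not> y \<in> A b \<and> y \<in> A (zs ! a) \<and> (\<forall>j\<in>{..<a}. \<not> y \<in> A (zs ! j))"
          by simp
      next
        assume r: "\<not> y \<in> A b \<and> y \<in> A (zs ! a) \<and> (\<forall>j\<in>{..<a}. \<not> y \<in> A (zs ! j))"
        have "(LEAST i. y \<in> A (zs ! i)) = a"
        proof (rule Least_equality)
          fix j assume j: "y \<in> A (zs ! j)"
          show "a \<le> j"
          proof (rule leI, rule notI)
            assume "j < a"
            then show False using j r by blast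
          qed
        qed (use r in blast)
        then show "p y = a" using r by (simp add: p_def)
      qed
      then have "{y\<in>Y. p y = a} =
          {y\<in>Y. \<not> y \<in> A b \<and> y \<in> A (zs ! a) \<and> (\<forall>j\<in>{..<a}. \<not> y \<in> A (zs ! j))}" by blast
      moreover have "clopen_in Y {y\<in>Y. y \<in> A z}" if "z \<in> Y" for z
      proof -
        have "{y\<in>Y. y \<in> A z} = A z" using clopen_in_subset[OF A(1)[OF that]] by blast
        then show ?thesis using A(1)[OF that] by simp
      qed
      ultimately show ?thesis
        using 2 bY zsY
        by (simp only:) (intro clopen_in_Collect_conj clopen_in_Collect_not clopen_in_Collect_ball; simp)
    next
      case 3
      then have eq: "{y\<in>Y. p y = a} = {}" using p_le by fastforce
      show ?thesis unfolding eq by (simp add: clopen_in_def)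
    qed
  qed
  have fin: "finite (p ` Y)" by (rule finite_subset[of _ "{..n}"]) (use p_le in auto)
  have "p b = n" using A(2)[OF bY] by (simp add: p_def)
  then have "n \<in> p ` Y" using bY by blast
  then have "\<exists>V. clopen_in Y V \<and> V \<noteq> {} \<and> (\<forall>v\<in>V. p v = n) \<and> card (return_word p V ` V) \<le> R"
    by (rule R[OF fin fib _ p_le])
  then obtain V where V: "clopen_in Y V" "V \<noteq> {}" "\<forall>v\<in>V. p v = n" "card (return_word p V ` V) \<le> R"
    by blast
  let ?K = "return_towers p V"
  note KV = KR_partition_return_towers[OF V(1,2) fin fib]
  have VA: "V \<subseteq> A b"
  proof
    fix v assume v: "v \<in> V"
    then have "v \<in> A (c (p v))" using clopen_in_subset[OF V(1)] Ac by blast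
    then show "v \<in> A b" using V(3) v by (simp add: c_def)
  qed
  have cell: "\<exists>z\<in>Y. C \<subseteq> A z" if C: "C \<in> KR_cells S ?K" for C
  proof -
    have CY: "C \<subseteq> Y" "C \<noteq> {}"
      using Union_KR_cells[OF KV(1)] KR_cell_nonempty[OF KV(1) C] C by blast+
    then obtain y where y: "y \<in> C" by blast
    have "C \<subseteq> A (c (p y))"
    proof
      fix z assume z: "z \<in> C"
      then have "z \<in> A (c (p z))" using CY(1) Ac by blast
      then show "z \<in> A (c (p y))" unfolding KV(4)[OF C z y] .
    qed
    then show ?thesis using cY[of y] y CY by blast
  qed
  show ?thesis
  proof (intro exI[of _ ?K] conjI ballI)
    show "KR_partition Y S ?K" by (rule KV(1))
    show "card ?K \<le> R" using KV(3) V(4) by (rule order_trans)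
    have "A b \<subseteq> B" by (rule A(4)[OF bY KR_partition_base_subset(4)[OF K b(1)] b(2)])
    then show "KR_base ?K \<subseteq> KR_base K"
      using VA b(1) unfolding KV(2) by (auto simp: KR_base_def)
    show "dist x y < e" if "x \<in> KR_base ?K" "y \<in> KR_base ?K" for x y
      using that VA small[OF bY] unfolding KV(2) by blast
    fix C assume C: "C \<in> KR_cells S ?K"
    obtain z where z: "z \<in> Y" "C \<subseteq> A z" using cell[OF C] by blast
    obtain D where D: "D \<in> KR_cells S K" "z \<in> D"
      using z(1) Union_KR_cells[OF K] by blast
    then show "\<exists>D\<in>KR_cells S K. C \<subseteq> D" using A(4)[OF z(1) D] z(2) by blast
    show "dist x y < e" if "x \<in> C" "y \<in> C" for x y
      using small[OF z(1)] z(2) that by blast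
  qed
qed

text \<open>Iterated refinement at scale \<open>inverse (real (Suc n))\<close>: small bases
  intersect in one point by compactness, and small cells form a basis of the topology.\<close>

lemma KR_realization_exists:
  assumes "1 \<le> R"
    and refine: "\<And>K e. KR_partition Y S K \<Longrightarrow> 0 < e \<Longrightarrow> \<exists>K'. KR_partition Y S K' \<and> card K' \<le> R \<and>
      KR_base K' \<subseteq> KR_base K \<and> (\<forall>C\<in>KR_cells S K'. \<exists>D\<in>KR_cells S K. C \<subseteq> D) \<and>
      (\<forall>C\<in>KR_cells S K'. \<forall>x\<in>C. \<forall>y\<in>C. dist x y < e) \<and>
      (\<forall>x\<in>KR_base K'. \<forall>y\<in>KR_base K'. dist x y < e)"
  obtains K where "KR_realization Y S K" "\<And>n. card (K n) \<le> R"
proof -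
  let ?P = "\<lambda>n K. KR_partition Y S K \<and> card K \<le> R"
  let ?Q = "\<lambda>n K K'. KR_base K' \<subseteq> KR_base K \<and> (\<forall>C\<in>KR_cells S K'. \<exists>D\<in>KR_cells S K. C \<subseteq> D) \<and>
      (\<forall>C\<in>KR_cells S K'. \<forall>x\<in>C. \<forall>y\<in>C. dist x y < inverse (real (Suc n))) \<and>
      (\<forall>x\<in>KR_base K'. \<forall>y\<in>KR_base K'. dist x y < inverse (real (Suc n)))"
  have "\<exists>K. \<forall>n. ?P n (K n) \<and> ?Q n (K n) (K (Suc n))"
  proof (rule dependent_nat_choice)
    show "\<exists>K. ?P 0 K"
      \<comment> \<open>The sequence starts with the single tower of height 1 over \<open>Y\<close>,
        which fits the bound because \<open>1 \<le> R\<close>.\<close>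
      using KR_partition_trivial assms(1) by (intro exI[of _ "{(Y, 1)}"]) simp
    fix K n assume "?P n K"
    then show "\<exists>K'. ?P (Suc n) K' \<and> ?Q n K K'"
      using refine[of K "inverse (real (Suc n))"] by auto
  qed
  then obtain K where "\<forall>n. ?P n (K n) \<and> ?Q n (K n) (K (Suc n))" ..
  note step = spec[OF this]
  have K: "\<And>n. KR_partition Y S (K n)" "\<And>n. card (K n) \<le> R"
    "\<And>n. KR_base (K (Suc n)) \<subseteq> KR_base (K n)"
    using step by blast+
  have refines: "\<exists>D\<in>KR_cells S (K n). C \<subseteq> D" if "C \<in> KR_cells S (K (Suc n))" for n C
    using step[of n] that by blast
  have small_cell: "dist x y < inverse (real (Suc n))"
    if "C \<in> KR_cells S (K (Suc n))" "x \<in> C" "y \<in> C" for n C x y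
    using step[of n] that by blast
  have small_base: "dist x y < inverse (real (Suc n))"
    if "x \<in> KR_base (K (Suc n))" "y \<in> KR_base (K (Suc n))" for n x y
    using step[of n] that by blast
  have base_ne: "KR_base (K n) \<noteq> {}" for n
  proof -
    obtain x where "x \<in> Y" using nonempty by blast
    then obtain B h b i where "(B, h) \<in> K n" "b \<in> B" using KR_partition_cover[OF K(1)] by metis
    then show ?thesis by (auto simp: KR_base_def)
  qed
  have "(\<Inter>n. KR_base (K n)) \<noteq> {}"
    using clopen_in_KR_base[OF K(1)] base_ne K(3)
    by (intro compact_decseq_Inter_nonempty[OF compact_space] decseq_SucI) (auto simp: clopen_in_def)
  then obtain x where x: "\<And>n. x \<in> KR_base (K n)" by blast
  have "y = x" if y: "\<And>n. y \<in> KR_base (K n)" for y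
  proof (rule ccontr)
    assume "y \<noteq> x"
    then obtain n where "inverse (real (Suc n)) < dist y x" using reals_Archimedean[of "dist y x"] by auto
    then show False using small_base[OF y x, of n] by simp
  qed
  then have "(\<Inter>n. KR_base (K n)) = {x}" using x by blast
  moreover have "topology_generated_by (\<Union>n. KR_cells S (K n)) = top_of_set Y"
    unfolding topology_eq
  proof (intro allI iffI)
    fix G assume "openin (topology_generated_by (\<Union>n. KR_cells S (K n))) G"
    then have "generate_topology_on (\<Union>n. KR_cells S (K n)) G"
      by (rule openin_topology_generated_by)
    then show "openin (top_of_set Y) G"
    proof (rule generate_topology_on_coarsest[rotated 2])
      show "istopology (openin (top_of_set Y))" by (rule istopology_openin)
      show "openin (top_of_set Y) C" if "C \<in> (\<Union>n. KR_cells S (K n))" for C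
        using that clopen_in_KR_cell[OF K(1)] unfolding clopen_in_def by blast
    qed
  next
    fix G assume G: "openin (top_of_set Y) G"
    have "\<exists>C\<in>(\<Union>n. KR_cells S (K n)). y \<in> C \<and> C \<subseteq> G" if y: "y \<in> G" for y
    proof -
      obtain e where e: "0 < e" "ball y e \<inter> Y \<subseteq> G"
        using G y by (auto simp: openin_contains_ball)
      obtain n where n: "inverse (real (Suc n)) < e" using reals_Archimedean[OF e(1)] by auto
      have "y \<in> Y" using G y openin_imp_subset by blast
      then obtain C where C: "C \<in> KR_cells S (K (Suc n))" "y \<in> C" "C \<subseteq> Y"
        using Union_KR_cells[OF K(1)[of "Suc n"]] by blast
      have "C \<subseteq> ball y e"
        using small_cell[OF C(1,2)] n by (force simp: subset_iff)
      then show ?thesis using C e by blast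
    qed
    then have "G = \<Union>{C. C \<in> (\<Union>n. KR_cells S (K n)) \<and> C \<subseteq> G}" by blast
    then show "openin (topology_generated_by (\<Union>n. KR_cells S (K n))) G"
      by (metis (no_types, lifting) mem_Collect_eq openin_Union topology_generated_by_Basis)
  qed
  ultimately have "KR_realization Y S K"
    unfolding KR_realization_def using K(1,3) refines by blast
  then show thesis using that K(2) by blast
qed

end

theorem mainTheorem2:
  fixes X :: "'a::metric_space set" and T :: "'a \<Rightarrow> 'a"
    and Y :: "'b::metric_space set" and S :: "'b \<Rightarrow> 'b"
    and \<alpha> :: "'a \<Rightarrow> 'b"
  assumes "Cantor_system X T"
    and "essentially_minimal X T"
    and "finite_topological_rank X T"
    and "Cantor_system Y S"
    and "minimal_system Y S"
    and "continuous_on X \<alpha>"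
    and "\<alpha> ` X \<subseteq> Y"
    and "\<forall>x\<in>X. \<alpha> (T x) = S (\<alpha> x)"
  shows "topological_rank Y S \<le> 3 * topological_rank X T"
proof -
  interpret minimal_dynamical_system Y S by unfold_locales (rule assms)
  have X: "topological_dynamical_system X T" using assms(1) by (simp add: Cantor_system_def)
  have td: "totally_disconnected Y" using assms(4) by (simp add: Cantor_system_def Cantor_space_def)
  let ?ranks = "{max_towers K | K. KR_realization X T K}"
  obtain K0 where K0: "KR_realization X T K0" "max_towers K0 < \<infinity>"
    using assms(3) by (auto simp: finite_topological_rank_def)
  then have "max_towers K0 \<in> ?ranks" by blast
  \<comment> \<open>A nonempty set of extended naturals contains its infimum, so an optimal
    realization of \<open>X\<close> is available.\<close>
  then have "topological_rank X T \<in> ?ranks"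
    unfolding topological_rank_def Inf_enat_def by (auto intro: LeastI)
  then obtain K where K: "KR_realization X T K" "topological_rank X T = max_towers K" by blast
  have "topological_rank X T \<le> max_towers K0"
    unfolding topological_rank_def using \<open>max_towers K0 \<in> ?ranks\<close> by (rule Inf_lower)
  then obtain r where r: "topological_rank X T = enat r" using K0(2) by (cases "topological_rank X T") auto
  have card: "card (K n) \<le> r" for n
  proof -
    have "enat (card (K n)) \<le> max_towers K" unfolding max_towers_def by (rule SUP_upper) simp
    then show ?thesis using K(2) r by (metis enat_ord_simps(1))
  qed
  have "1 \<le> r"
  proof -
    interpret X: dynamical_system X T by unfold_locales (rule X)
    have "KR_partition X T (K 0)" using K(1) by (simp add: KR_realization_def)
    moreover obtain x where "x \<in> X" using X.nonempty by blast
    ultimately obtain B h b i where "(B, h) \<in> K 0" using X.KR_partition_cover by metis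
    moreover have "finite (K 0)" using \<open>KR_partition X T (K 0)\<close> by (simp add: KR_partition_def)
    ultimately show ?thesis using card[of 0] by (metis One_nat_def Suc_leI card_gt_0_iff empty_iff le_trans)
  qed
  have equi: "\<alpha> (T x) = S (\<alpha> x)" if "x \<in> X" for x using that assms(8) by blast
  have words: "\<exists>V. clopen_in Y V \<and> V \<noteq> {} \<and> (\<forall>v\<in>V. p v = M) \<and> card (return_word p V ` V) \<le> 3 * r"
    if "finite (p ` Y)" "\<And>a. clopen_in Y {y\<in>Y. p y = a}" "M \<in> p ` Y" "\<And>y. y \<in> Y \<Longrightarrow> p y \<le> M"
    for p :: "'b \<Rightarrow> nat" and M
    by (rule bounded_return_words_factor[OF X K(1) card assms(6,7) equi that])
  obtain L where L: "KR_realization Y S L" "\<And>n. card (L n) \<le> 3 * r"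
  proof (rule KR_realization_exists[of "3 * r"])
    show "1 \<le> 3 * r" using \<open>1 \<le> r\<close> by simp
    fix K e assume "KR_partition Y S K" "0 < (e::real)"
    from KR_partition_refine[OF td words this] show "\<exists>K'. KR_partition Y S K' \<and> card K' \<le> 3 * r \<and>
      KR_base K' \<subseteq> KR_base K \<and> (\<forall>C\<in>KR_cells S K'. \<exists>D\<in>KR_cells S K. C \<subseteq> D) \<and>
      (\<forall>C\<in>KR_cells S K'. \<forall>x\<in>C. \<forall>y\<in>C. dist x y < e) \<and>
      (\<forall>x\<in>KR_base K'. \<forall>y\<in>KR_base K'. dist x y < e)" .
  qed (rule that)
  have "topological_rank Y S \<le> max_towers L"
    unfolding topological_rank_def using L(1) by (intro Inf_lower) blast
  also have "\<dots> \<le> enat (3 * r)"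
    unfolding max_towers_def using L(2) by (intro SUP_least) simp
  also have "\<dots> = 3 * topological_rank X T"
    by (simp add: r numeral_eq_enat)
  finally show ?thesis .
qed

end
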